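(* Let $\Lambda=\{\lambda_n\}_{n=1}^\infty$ be a sequence of positive numbers such that $$\sum_{j=1}^{\infty}\frac{\lambda_j}{j^2}<\infty\qquad\text{and}\qquad \frac{\lambda_j}{j}\downarrow 0$$ (that is, $\lambda_j/j$ is nonincreasing in $j$ and tends to $0$). Let $f\in P\Lambda BV$ with $f\in L^1(T^2)$. Then: (i) at every point $(x,y)$ at which the four open quadrant limits $f(x\pm0,y\pm0)$ exist, the Fourier series $S[f]$ converges at $(x,y)$ to $\frac14\sum f(x\pm0,y\pm0)$; (ii) the convergence is uniform on every compact set $K$ at every point of which $f$ is continuous.
   Context: $T=[0,2\pi]$, $T^2=[0,2\pi]^2$, and $f$ is a real function of two variables, $2\pi$-periodic in each variable. For intervals $I=(a,b)\subset T$, $J=(c,d)\subset T$ and $x,y\in T$: $f(I,y)=f(b,y)-f(a,y)$ and $f(x,J)=f(x,d)-f(x,c)$. Let $\Omega$ be the set of all collections $E=\{I_i\}$ of nonoverlapping intervals in $T$, ordered in an arbitrary way. For a sequence of positive numbers $\Lambda=\{\lambda_n\}$, $$\Lambda V_1(f)=\sup_{y}\sup_{E=\{I_i\}\in\Omega}\sum_i\frac{|f(I_i,y)|}{\lambda_i},\qquad \Lambda V_2(f)=\sup_{x}\sup_{F=\{J_j\}\in\Omega}\sum_j\frac{|f(x,J_j)|}{\lambda_j}.$$ $f\in P\Lambda BV$ (bounded partial $\Lambda$-variation) means $\Lambda V_1(f)+\Lambda V_2(f)<\infty$. For $f\in L^1(T^2)$, $\widehat f(m,n)=\frac1{4\pi^2}\int_0^{2\pi}\int_0^{2\pi}f(x,y)e^{-imx}e^{-iny}\,dx\,dy$,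 the Fourier series is $S[f]=\sum_{m,n}\widehat f(m,n)e^{imx}e^{iny}$, and its rectangular partial sums are $S_{M,N}[f,(x,y)]=\sum_{m=-M}^{M}\sum_{n=-N}^{N}\widehat f(m,n)e^{imx}e^{iny}$. Convergence of $S[f]$ (pointwise or uniform) means convergence of $S_{M,N}[f,\cdot]$ in the sense of Pringsheim, i.e. as $\min(M,N)\to\infty$. $f(x\pm0,y\pm0)$ denote the open coordinate quadrant limits at $(x,y)$; e.g. $f(x+0,y-0)$ is the limit of $f(s,t)$ as $(s,t)\to(x,y)$ with $s>x$, $t<y$. Also $\frac14\sum f(x\pm0,y\pm0)$ denotes the arithmetic mean $\frac14\{f(x+0,y+0)+f(x+0,y-0)+f(x-0,y+0)+f(x-0,y-0)\}$. *)

theory Defs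
  imports "HOL-Analysis.Analysis"
begin

abbreviation torus :: "real set" where
  "torus \<equiv> {0..2 * pi}"

text \<open>
  A collection of nonoverlapping intervals, listed in some order \<open>I\<^sub>1, I\<^sub>2, \<dots>\<close>, is a pair
  \<open>(A, I)\<close>: the index set \<open>A\<close> is an initial segment of the positive integers (finite or not)
  and \<open>I i = (a, b)\<close> holds the end points of the \<open>i\<close>-th open interval. No index is skipped:
  the weights below need not be monotone, so gaps could change the variation.
\<close>
definition ordered_intervals :: "(nat set \<times> (nat \<Rightarrow> real \<times> real)) set" where
  "ordered_intervals =
     {(A, I). (A = {1..} \<or> (\<exists>n. A = {1..n})) \<and>
        (\<forall>i\<in>A. 0 \<le> fst (I i) \<and> fst (I i) < snd (I i) \<and> snd (I i) \<le> 2 * pi) \<and>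
        disjoint_family_on (\<lambda>i. {fst (I i)<..<snd (I i)}) A}"

text \<open>Only the values \<open>\<Lambda> 1, \<Lambda> 2, \<dots>\<close> of the weight sequence are used.\<close>
definition Lambda_V1 :: "(nat \<Rightarrow> real) \<Rightarrow> (real \<times> real \<Rightarrow> real) \<Rightarrow> ennreal" where
  "Lambda_V1 \<Lambda> f =
     (SUP y\<in>torus. SUP (A, I)\<in>ordered_intervals.
        \<Sum>\<^sub>\<infinity>i\<in>A. ennreal (\<bar>f (snd (I i), y) - f (fst (I i), y)\<bar> / \<Lambda> i))"

definition Lambda_V2 :: "(nat \<Rightarrow> real) \<Rightarrow> (real \<times> real \<Rightarrow> real) \<Rightarrow> ennreal" where
  "Lambda_V2 \<Lambda> f =
     (SUP x\<in>torus. SUP (A, J)\<in>ordered_intervals.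
        \<Sum>\<^sub>\<infinity>j\<in>A. ennreal (\<bar>f (x, snd (J j)) - f (x, fst (J j))\<bar> / \<Lambda> j))"

definition PLambdaBV :: "(nat \<Rightarrow> real) \<Rightarrow> (real \<times> real \<Rightarrow> real) set" where
  "PLambdaBV \<Lambda> = {f. Lambda_V1 \<Lambda> f + Lambda_V2 \<Lambda> f < \<infinity>}"

definition fourier_coeff2 :: "(real \<times> real \<Rightarrow> real) \<Rightarrow> int \<Rightarrow> int \<Rightarrow> complex" where
  "fourier_coeff2 f m n =
     1 / (4 * complex_of_real pi ^ 2) *
     set_lebesgue_integral lebesgue (torus \<times> torus)
       (\<lambda>(x, y). complex_of_real (f (x, y)) *
          exp (- \<i> * of_int m * of_real x) * exp (- \<i> * of_int n * of_real y))"

definition rect_partial_sum ::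
    "(real \<times> real \<Rightarrow> real) \<Rightarrow> nat \<Rightarrow> nat \<Rightarrow> real \<times> real \<Rightarrow> complex" where
  "rect_partial_sum f M N =
     (\<lambda>(x, y). \<Sum>m = - int M..int M. \<Sum>n = - int N..int N.
        fourier_coeff2 f m n *
          exp (\<i> * of_int m * of_real x) * exp (\<i> * of_int n * of_real y))"

text \<open>Convergence along this filter is convergence as \<open>min M N\<close> tends to infinity.\<close>
abbreviation pringsheim :: "(nat \<times> nat) filter" where
  "pringsheim \<equiv> sequentially \<times>\<^sub>F sequentially"

end

theory Submission
  imports Defs
begin

text \<open>
  The rectangular partial sum at \<open>(x, y)\<close> is \<open>1 / \<pi>\<^sup>2\<close> times the sum over the four sign choices of the
  integrals of \<open>f (x \<plusminus> s, y \<plusminus> t) D\<^sub>M s D\<^sub>N t\<close> over \<open>[0, \<pi>]\<^sup>2\<close>, so it suffices that such a quadrant integral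
  of \<open>\<phi>\<close> (that is, \<open>f\<close> minus its quadrant limit) is small. Cutting the quadrant into cells of side
  \<open>\<pi> / (M + 1/2)\<close> and \<open>\<pi> / (N + 1/2)\<close> and translating them all to the first cell turns the integrand into an
  alternating double sum over the cells, with decreasing weights of order \<open>1 / (i j)\<close>; two summations
  by parts bound it by \<open>\<Sum>\<close> \<open>|\<Delta>\<Delta>\<phi>| / (i j)\<close>. Cells with \<open>i, j \<le> m\<close> lie near the corner, where \<open>\<phi>\<close> is
  small. For \<open>i \<ge> j\<close> and \<open>i > m\<close>, summing over \<open>i\<close> first with the variation in \<open>x\<close> alone leaves
  \<open>\<Sum>\<close> \<open>\<Lambda> k / (k j)\<close> over \<open>j\<close>, where \<open>k = max j m\<close>, because \<open>\<Lambda> i / i\<close> decreases; this tends to \<open>0\<close> as \<open>m \<rightarrow> \<infinity>\<close>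
  by summability of \<open>\<Lambda> j / j\<^sup>2\<close>. The case \<open>j > i\<close> is symmetric. All bounds are uniform in \<open>(x, y)\<close>, which
  gives the uniform statement. Estimating the folded integrand pointwise avoids the sections of
  \<open>f\<close>, which need not be treated as measurable.
\<close>

section \<open>Summation by parts and weighted double sums\<close>

text \<open>The value at 0 treats \<open>c\<close> as extended by zero to the left, so the
  differences up to \<open>n\<close> add up to exactly \<open>c n\<close> and summation by parts has
  no boundary term.\<close>

definition bdiff :: "(nat \<Rightarrow> 'a::ab_group_add) \<Rightarrow> nat \<Rightarrow> 'a" where
  "bdiff c i = (if i = 0 then c 0 else c i - c (i - 1))"

text \<open>Tails of \<open>a\<close>, not initial sums, are kept: for alternating terms with
  decreasing weights the tail starting at \<open>i\<close> is as small as the weight at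
  \<open>i\<close>, so the decay in \<open>i\<close> survives.\<close>

lemma summation_by_parts:
  fixes c a :: "nat \<Rightarrow> real"
  shows "(\<Sum>i\<le>n. c i * a i) = (\<Sum>i\<le>n. bdiff c i * (\<Sum>l=i..n. a l))"
proof (induction n)
  case (Suc n)
  have "(\<Sum>i\<le>n. bdiff c i) = c n" for n
    by (induction n) (auto simp: bdiff_def)
  moreover have "(\<Sum>i\<le>n. bdiff c i * (\<Sum>l=i..Suc n. a l)) =
      (\<Sum>i\<le>n. bdiff c i * (\<Sum>l=i..n. a l)) + (\<Sum>i\<le>n. bdiff c i) * a (Suc n)"
    unfolding sum_distrib_right sum.distrib[symmetric]
    by (intro sum.cong) (auto simp: algebra_simps)
  ultimately show ?case
    using Suc by (simp add: bdiff_def algebra_simps)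
qed (simp add: bdiff_def)

lemma double_summation_by_parts:
  fixes a b :: "nat \<Rightarrow> real" and c :: "nat \<Rightarrow> nat \<Rightarrow> real"
  shows "(\<Sum>i\<le>m. \<Sum>j\<le>n. c i j * a i * b j) =
    (\<Sum>i\<le>m. \<Sum>j\<le>n. bdiff (\<lambda>j. bdiff (\<lambda>i. c i j) i) j * (\<Sum>l=i..m. a l) * (\<Sum>l=j..n. b l))"
proof -
  have "(\<Sum>i\<le>m. \<Sum>j\<le>n. c i j * a i * b j) = (\<Sum>i\<le>m. (\<Sum>j\<le>n. c i j * b j) * a i)"
    by (simp add: sum_distrib_left mult_ac)
  also have "\<dots> = (\<Sum>i\<le>m. bdiff (\<lambda>i. \<Sum>j\<le>n. c i j * b j) i * (\<Sum>l=i..m. a l))"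
    by (rule summation_by_parts)
  \<comment> \<open>Differencing in \<open>i\<close> commutes with the inner sum, so the second
    application can work on \<open>j\<close> with \<open>i\<close> fixed.\<close>
  also have "(\<lambda>i. bdiff (\<lambda>i. \<Sum>j\<le>n. c i j * b j) i) = (\<lambda>i. \<Sum>j\<le>n. bdiff (\<lambda>i. c i j) i * b j)"
    by (auto simp: bdiff_def sum_subtractf left_diff_distrib)
  also have "(\<lambda>i. \<Sum>j\<le>n. bdiff (\<lambda>i. c i j) i * b j) =
      (\<lambda>i. \<Sum>j\<le>n. bdiff (\<lambda>j. bdiff (\<lambda>i. c i j) i) j * (\<Sum>l=j..n. b l))"
    by (intro ext summation_by_parts)
  finally show ?thesis
    by (simp only: sum_distrib_right) (simp only: mult_ac)
qed

text \<open>Splitting off the first term leaves \<open>a 0\<close> minus a sum of the same kind for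
  the shifted sequence, which by induction lies between 0 and \<open>a 1\<close>.\<close>

lemma alternating_sum_bounds:
  fixes a :: "nat \<Rightarrow> real"
  assumes "\<And>i. 0 \<le> a i" "\<And>i. a (Suc i) \<le> a i"
  shows "0 \<le> (\<Sum>l\<le>n. (-1) ^ l * a l) \<and> (\<Sum>l\<le>n. (-1) ^ l * a l) \<le> a 0"
  using assms
proof (induction n arbitrary: a)
  case (Suc n)
  have "(\<Sum>l\<le>Suc n. (-1) ^ l * a l) = a 0 - (\<Sum>l\<le>n. (-1) ^ l * a (Suc l))"
    by (subst sum.atMost_Suc_shift) (simp add: sum_negf)
  moreover have "0 \<le> (\<Sum>l\<le>n. (-1) ^ l * a (Suc l)) \<and> (\<Sum>l\<le>n. (-1) ^ l * a (Suc l)) \<le> a 1"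
    using Suc.IH[of "\<lambda>l. a (Suc l)"] Suc.prems by simp
  ultimately show ?case
    using Suc.prems(2)[of 0] by simp
qed simp

lemma alternating_tail_bound:
  fixes a :: "nat \<Rightarrow> real"
  assumes "\<And>i. 0 \<le> a i" "\<And>i. a (Suc i) \<le> a i"
  shows "\<bar>\<Sum>l=i..n. (-1) ^ l * a l\<bar> \<le> a i"
proof (cases "i \<le> n")
  case True
  have "(\<Sum>l=i..n. (-1) ^ l * a l) = (\<Sum>l=0..n-i. (-1) ^ (l + i) * a (l + i))"
    using True sum.shift_bounds_cl_nat_ivl[of "\<lambda>l. (-1) ^ l * a l" 0 i "n - i"] by simp
  also have "\<dots> = (-1) ^ i * (\<Sum>l\<le>n-i. (-1) ^ l * a (l + i))"
    by (simp add: power_add sum_distrib_left mult_ac atLeast0AtMost)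
  finally have "\<bar>\<Sum>l=i..n. (-1) ^ l * a l\<bar> = \<bar>\<Sum>l\<le>n-i. (-1) ^ l * a (l + i)\<bar>"
    by (simp add: abs_mult)
  then show ?thesis
    using alternating_sum_bounds[of "\<lambda>l. a (l + i)" "n - i"] assms by simp
qed (use assms in simp)

text \<open>A mixed difference is controlled by variation in the first index alone, along two
  neighbouring lines. For \<open>j = 0\<close> truncated subtraction makes the two lines coincide;
  the bound still holds because \<open>bdiff\<close> then takes no difference in
  \<open>j\<close>.\<close>

lemma bdiff_bdiff_le:
  fixes c :: "nat \<Rightarrow> nat \<Rightarrow> real"
  assumes "i > 0"
  shows "\<bar>bdiff (\<lambda>j. bdiff (\<lambda>i. c i j) i) j\<bar>
    \<le> \<bar>c i j - c (i - 1) j\<bar> + \<bar>c i (j - 1) - c (i - 1) (j - 1)\<bar>"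
  using assms abs_triangle_ineq4[of "c i j - c (i - 1) j"]
  by (simp add: bdiff_def)

lemma abs_bdiff_le:
  fixes c :: "nat \<Rightarrow> real"
  assumes "\<bar>c i\<bar> \<le> b" "\<bar>c (i - 1)\<bar> \<le> b"
  shows "\<bar>bdiff c i\<bar> \<le> 2 * b"
  using assms unfolding bdiff_def by auto

lemma bdiff_bdiff_swap:
  fixes c :: "nat \<Rightarrow> nat \<Rightarrow> real"
  shows "bdiff (\<lambda>j. bdiff (\<lambda>i. c i j) i) j = bdiff (\<lambda>i. bdiff (\<lambda>j. c i j) j) i"
  by (simp add: bdiff_def)

text \<open>Only index pairs with \<open>j \<le> i\<close> and \<open>m < i\<close> count: there \<open>\<Lambda> i / i \<le> \<Lambda> (max j m) / max j m\<close>, so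
  that variation in the direction of the larger index alone controls the double sum.\<close>
lemma off_corner_sum_le:
  fixes R :: "nat \<Rightarrow> nat \<Rightarrow> real" and \<Lambda> :: "nat \<Rightarrow> real"
  assumes pos: "\<And>j. j \<ge> 1 \<Longrightarrow> \<Lambda> j > 0"
    and mono: "\<And>i j. 1 \<le> i \<Longrightarrow> i \<le> j \<Longrightarrow> \<Lambda> j / real j \<le> \<Lambda> i / real i"
    and m: "m \<ge> 1"
    and S: "(\<Sum>j\<le>N. \<Lambda> (max j m) / real (max j m) / real (Suc j)) \<le> S"
    and R0: "\<And>i j. R i j \<ge> 0"
    and W: "\<And>j. j \<le> N \<Longrightarrow> (\<Sum>i=1..M. R i j / \<Lambda> i) \<le> W"
    and "W \<ge> 0"
  shows "(\<Sum>i\<le>M. \<Sum>j\<le>N. if m < i \<and> j \<le> i then R i j / (real (Suc i) * real (Suc j)) else 0) \<le> S * W"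
proof -
  let ?r = "\<lambda>j. \<Lambda> (max j m) / real (max j m)"
  have r0: "?r j \<ge> 0" for j
    using pos[of "max j m"] m by (simp add: less_imp_le)
  have term_le: "(if m < i \<and> j \<le> i then R i j / (real (Suc i) * real (Suc j)) else 0)
      \<le> ?r j / real (Suc j) * (if 1 \<le> i then R i j / \<Lambda> i else 0)" for i j
  proof (cases "m < i \<and> j \<le> i")
    case True
    then have i: "i \<ge> 1" and \<Lambda>: "\<Lambda> i > 0" using pos m by auto
    have "R i j / real (Suc i) \<le> R i j / real i"
      using R0[of i j] i by (intro divide_left_mono) auto
    also have "\<dots> = \<Lambda> i / real i * (R i j / \<Lambda> i)" using \<Lambda> by simp
    also have "\<dots> \<le> ?r j * (R i j / \<Lambda> i)"
      using True m R0[of i j] \<Lambda> by (intro mult_right_mono mono) auto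
    finally have "R i j / real (Suc i) / real (Suc j) \<le> ?r j * (R i j / \<Lambda> i) / real (Suc j)"
      by (intro divide_right_mono) auto
    then show ?thesis using True i by (simp add: mult_ac)
  next
    case False
    have "0 \<le> ?r j / real (Suc j) * (if 1 \<le> i then R i j / \<Lambda> i else 0)"
      using R0[of i j] pos[of i] by (intro mult_nonneg_nonneg divide_nonneg_nonneg[OF r0]) (auto simp: less_imp_le)
    then show ?thesis unfolding if_not_P[OF False] .
  qed
  have "(\<Sum>i\<le>M. \<Sum>j\<le>N. if m < i \<and> j \<le> i then R i j / (real (Suc i) * real (Suc j)) else 0)
      \<le> (\<Sum>i\<le>M. \<Sum>j\<le>N. ?r j / real (Suc j) * (if 1 \<le> i then R i j / \<Lambda> i else 0))"
    by (intro sum_mono term_le)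
  also have "\<dots> = (\<Sum>j\<le>N. \<Sum>i\<le>M. ?r j / real (Suc j) * (if 1 \<le> i then R i j / \<Lambda> i else 0))"
    by (rule sum.swap)
  also have "\<dots> = (\<Sum>j\<le>N. ?r j / real (Suc j) * (\<Sum>i=1..M. R i j / \<Lambda> i))"
  proof (intro sum.cong refl)
    fix j
    have "(\<Sum>i\<le>M. if 1 \<le> i then R i j / \<Lambda> i else 0) = (\<Sum>i=1..M. R i j / \<Lambda> i)"
      by (rule sum.mono_neutral_cong_right) auto
    then show "(\<Sum>i\<le>M. ?r j / real (Suc j) * (if 1 \<le> i then R i j / \<Lambda> i else 0)) =
        ?r j / real (Suc j) * (\<Sum>i=1..M. R i j / \<Lambda> i)"
      by (simp only: sum_distrib_left[symmetric])
  qed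
  also have "\<dots> \<le> (\<Sum>j\<le>N. ?r j / real (Suc j) * W)"
    using W by (intro sum_mono mult_left_mono divide_nonneg_nonneg r0) auto
  also have "\<dots> = (\<Sum>j\<le>N. ?r j / real (Suc j)) * W"
    by (simp add: sum_distrib_right)
  also have "\<dots> \<le> S * W"
    using S \<open>W \<ge> 0\<close> by (intro mult_right_mono) auto
  finally show ?thesis .
qed

text \<open>The larger index decides which variation is used. A mixed difference has at most four
  terms, so each of the at most \<open>(Suc m)\<^sup>2\<close> corner cells costs at most
  \<open>4 * \<eta>\<close>. It also touches two neighbouring lines, so each of the two off-corner
  regions costs \<open>S * (2 * V)\<close>. The factor \<open>C\<^sup>2\<close> comes from the
  bounds on \<open>P\<close> and \<open>Q\<close>.\<close>

lemma double_sum_bdiff_le: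
  fixes c :: "nat \<Rightarrow> nat \<Rightarrow> real" and \<Lambda> P Q :: "nat \<Rightarrow> real"
  assumes pos: "\<And>j. j \<ge> 1 \<Longrightarrow> \<Lambda> j > 0"
    and mono: "\<And>i j. 1 \<le> i \<Longrightarrow> i \<le> j \<Longrightarrow> \<Lambda> j / real j \<le> \<Lambda> i / real i"
    and m: "m \<ge> 1"
    and S: "\<And>n. (\<Sum>j\<le>n. \<Lambda> (max j m) / real (max j m) / real (Suc j)) \<le> S"
    and V0: "V \<ge> 0" and \<eta>: "\<eta> \<ge> 0"
    and V1: "\<And>j. j \<le> N \<Longrightarrow> (\<Sum>i=1..M. \<bar>c i j - c (i - 1) j\<bar> / \<Lambda> i) \<le> V"
    and V2: "\<And>i. i \<le> M \<Longrightarrow> (\<Sum>j=1..N. \<bar>c i j - c i (j - 1)\<bar> / \<Lambda> j) \<le> V"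
    and corner: "\<And>i j. i \<le> m \<Longrightarrow> j \<le> m \<Longrightarrow> i \<le> M \<Longrightarrow> j \<le> N \<Longrightarrow> \<bar>c i j\<bar> \<le> \<eta>"
    and P: "\<And>i. \<bar>P i\<bar> \<le> C / real (Suc i)" and Q: "\<And>j. \<bar>Q j\<bar> \<le> C / real (Suc j)"
  shows "\<bar>\<Sum>i\<le>M. \<Sum>j\<le>N. bdiff (\<lambda>j. bdiff (\<lambda>i. c i j) i) j * P i * Q j\<bar>
    \<le> C\<^sup>2 * (4 * \<eta> * (real (Suc m))\<^sup>2 + 4 * S * V)"
proof -
  let ?D = "\<lambda>i j. bdiff (\<lambda>j. bdiff (\<lambda>i. c i j) i) j"
  let ?w = "\<lambda>i j. real (Suc i) * real (Suc j)"
  let ?R = "\<lambda>i j. \<bar>c i j - c (i - 1) j\<bar> + \<bar>c i (j - 1) - c (i - 1) (j - 1)\<bar>"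
  let ?R' = "\<lambda>j i. \<bar>c i j - c i (j - 1)\<bar> + \<bar>c (i - 1) j - c (i - 1) (j - 1)\<bar>"
  let ?X = "\<lambda>i j. if m < i \<and> j \<le> i then ?R i j / ?w i j else 0"
  let ?Y = "\<lambda>j i. if m < j \<and> i \<le> j then ?R' j i / ?w j i else 0"
  let ?Z = "\<lambda>i j. if i \<le> m \<and> j \<le> m then 4 * \<eta> else 0"
  have C0: "C \<ge> 0"
    using P[of 0] by simp
  define X Y Z where "X = ?X" and "Y = ?Y" and "Z = ?Z"
  have nonneg: "X i j \<ge> 0" "Y i j \<ge> 0" "Z i j \<ge> 0" for i j
    using \<eta> by (simp_all add: X_def Y_def Z_def)
  have D_le: "\<bar>?D i j\<bar> / ?w i j \<le> Z i j + X i j + Y j i" if ij: "i \<le> M" "j \<le> N" for i j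
  proof -
    \<comment> \<open>The last two regions overlap on the diagonal. This is harmless: the three
      bounds are nonnegative, so any one that applies is below their sum.\<close>
    consider "i \<le> m" "j \<le> m" | "m < i" "j \<le> i" | "m < j" "i \<le> j"
      by linarith
    then have "\<bar>?D i j\<bar> / ?w i j \<le> Z i j \<or> \<bar>?D i j\<bar> / ?w i j \<le> X i j \<or> \<bar>?D i j\<bar> / ?w i j \<le> Y j i"
    proof cases
      case 1
      then have "\<bar>?D i j\<bar> \<le> 2 * (2 * \<eta>)"
        using ij by (intro abs_bdiff_le corner) auto
      moreover have "\<bar>?D i j\<bar> / ?w i j \<le> \<bar>?D i j\<bar> / 1"
        by (intro divide_left_mono) (auto intro: mult_ge1_I)
      ultimately have "\<bar>?D i j\<bar> / ?w i j \<le> 4 * \<eta>"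
        by simp
      then show ?thesis using 1 by (simp add: Z_def)
    next
      case 2
      then have "\<bar>?D i j\<bar> / ?w i j \<le> ?R i j / ?w i j"
        by (intro divide_right_mono bdiff_bdiff_le) auto
      then show ?thesis using 2 by (simp add: X_def)
    next
      case 3
      then have "\<bar>?D i j\<bar> / ?w i j \<le> ?R' j i / ?w i j"
        unfolding bdiff_bdiff_swap[of c]
        by (intro divide_right_mono bdiff_bdiff_le[of j "\<lambda>j i. c i j"]) auto
      then show ?thesis using 3 by (simp add: Y_def mult.commute)
    qed
    then show ?thesis
      using nonneg(1)[of i j] nonneg(2)[of j i] nonneg(3)[of i j] by linarith
  qed
  have X: "(\<Sum>i\<le>M. \<Sum>j\<le>N. X i j) \<le> S * (2 * V)"
  unfolding X_def
  proof (rule off_corner_sum_le[OF pos mono m S])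
    fix j assume "j \<le> N"
    then show "(\<Sum>i=1..M. ?R i j / \<Lambda> i) \<le> 2 * V"
      unfolding add_divide_distrib sum.distrib mult_2
      by (intro add_mono V1) auto
  qed (use V0 in auto)
  have Y: "(\<Sum>i\<le>M. \<Sum>j\<le>N. Y j i) \<le> S * (2 * V)"
    unfolding Y_def sum.swap[of _ "{..N}" "{..M}"]
  proof (rule off_corner_sum_le[OF pos mono m S])
    fix i assume "i \<le> M"
    then show "(\<Sum>j=1..N. ?R' j i / \<Lambda> j) \<le> 2 * V"
      unfolding add_divide_distrib sum.distrib mult_2
      by (intro add_mono V2) auto
  qed (use V0 in auto)
  have Z: "(\<Sum>i\<le>M. \<Sum>j\<le>N. Z i j) \<le> 4 * \<eta> * (real (Suc m))\<^sup>2"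
  proof -
    have "(\<Sum>i\<le>M. \<Sum>j\<le>N. Z i j) = (\<Sum>(i,j)\<in>{..M}\<times>{..N}. ?Z i j)"
      by (simp add: Z_def sum.cartesian_product)
    also have "\<dots> = (\<Sum>(i,j)\<in>({..M}\<inter>{..m})\<times>({..N}\<inter>{..m}). 4 * \<eta>)"
      by (rule sum.mono_neutral_cong_right) (auto split: if_splits)
    also have "\<dots> \<le> (\<Sum>(i,j)\<in>{..m}\<times>{..m}. 4 * \<eta>)"
      using \<eta> by (intro sum_mono2) auto
    finally show ?thesis by (simp add: power2_eq_square algebra_simps)
  qed
  have "\<bar>\<Sum>i\<le>M. \<Sum>j\<le>N. ?D i j * P i * Q j\<bar> \<le> (\<Sum>i\<le>M. \<Sum>j\<le>N. \<bar>?D i j * P i * Q j\<bar>)"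
    by (intro order.trans[OF sum_abs] sum_mono sum_abs)
  also have "\<dots> \<le> (\<Sum>i\<le>M. \<Sum>j\<le>N. C\<^sup>2 * (\<bar>?D i j\<bar> / ?w i j))"
  proof (intro sum_mono)
    fix i j
    have "\<bar>P i\<bar> * \<bar>Q j\<bar> \<le> C / real (Suc i) * (C / real (Suc j))"
      using C0 by (intro mult_mono P Q) auto
    then have "\<bar>?D i j\<bar> * (\<bar>P i\<bar> * \<bar>Q j\<bar>) \<le> \<bar>?D i j\<bar> * (C / real (Suc i) * (C / real (Suc j)))"
      by (intro mult_left_mono) auto
    then show "\<bar>?D i j * P i * Q j\<bar> \<le> C\<^sup>2 * (\<bar>?D i j\<bar> / ?w i j)"
      by (simp add: abs_mult power2_eq_square mult_ac)
  qed
  also have "\<dots> \<le> (\<Sum>i\<le>M. \<Sum>j\<le>N. C\<^sup>2 * (Z i j + X i j + Y j i))"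
    by (intro sum_mono mult_left_mono D_le) auto
  also have "\<dots> = C\<^sup>2 * ((\<Sum>i\<le>M. \<Sum>j\<le>N. Z i j) + (\<Sum>i\<le>M. \<Sum>j\<le>N. X i j) + (\<Sum>i\<le>M. \<Sum>j\<le>N. Y j i))"
    by (simp only: sum.distrib sum_distrib_left[symmetric])
  also have "\<dots> \<le> C\<^sup>2 * (4 * \<eta> * (real (Suc m))\<^sup>2 + 4 * S * V)"
    using X Y Z by (intro mult_left_mono) auto
  finally show ?thesis .
qed

text \<open>Dominated convergence by hand. Summability gives a cut \<open>k\<close> beyond which the
  sum is at most \<open>e / 2\<close> for every \<open>m\<close>. Then \<open>m\<close> is taken so
  large that \<open>\<Lambda> m / m\<close> is below \<open>e / (2 * k)\<close>; each of the at most
  \<open>k\<close> terms before the cut is bounded by \<open>\<Lambda> m / m\<close>, so together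
  they also stay below \<open>e / 2\<close>.\<close>

lemma truncated_weight_sum_small:
  fixes \<Lambda> :: "nat \<Rightarrow> real"
  assumes pos: "\<And>j. j \<ge> 1 \<Longrightarrow> \<Lambda> j > 0"
    and summ: "summable (\<lambda>j. \<Lambda> (Suc j) / real (Suc j) ^ 2)"
    and mono: "\<And>i j. 1 \<le> i \<Longrightarrow> i \<le> j \<Longrightarrow> \<Lambda> j / real j \<le> \<Lambda> i / real i"
    and lim: "(\<lambda>j. \<Lambda> j / real j) \<longlonglongrightarrow> 0"
    and e: "e > 0"
  obtains m where "m \<ge> 1" "\<And>n. (\<Sum>j\<le>n. \<Lambda> (max j m) / real (max j m) / real (Suc j)) \<le> e"
proof -
  let ?a = "\<lambda>j. \<Lambda> (Suc j) / real (Suc j) ^ 2"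
  have a0: "?a j \<ge> 0" for j
    using pos[of "Suc j"] by simp
  obtain k0 where k0: "\<And>n. n \<ge> k0 \<Longrightarrow> norm (\<Sum>i. ?a (i + n)) < e / 2"
    using suminf_exist_split[OF _ summ, of "e / 2"] e by auto
  \<comment> \<open>The series is indexed through \<open>Suc j\<close>, so its tail from
    \<open>k0\<close> begins with the term of \<open>\<Lambda> (k0 + 1)\<close>. This also makes
    \<open>k\<close> positive, as the division by \<open>k\<close> requires.\<close>
  define k where "k = k0 + 1"
  have tail: "(\<Sum>j\<in>A. \<Lambda> j / real j / real (Suc j)) \<le> e / 2"
    if A: "finite A" "\<And>j. j \<in> A \<Longrightarrow> k \<le> j" for A
  proof -
    have "(\<Sum>j\<in>A. \<Lambda> j / real j / real (Suc j)) \<le> (\<Sum>j\<in>A. ?a (j - 1))"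
    proof (intro sum_mono)
      fix j assume "j \<in> A"
      then have j: "j \<ge> 1" using A unfolding k_def by fastforce
      have "\<Lambda> j / real j / real (Suc j) \<le> \<Lambda> j / real j / real j"
        using j pos[of j] by (intro divide_left_mono) auto
      then show "\<Lambda> j / real j / real (Suc j) \<le> ?a (j - 1)"
        using j by (simp add: power2_eq_square)
    qed
    also have "\<dots> = (\<Sum>i\<in>(\<lambda>j. j - k) ` A. ?a (i + k0))"
    proof (subst sum.reindex)
      show "inj_on (\<lambda>j. j - k) A"
        using A(2) by (auto intro!: inj_onI simp: eq_diff_iff)
      show "(\<Sum>j\<in>A. ?a (j - 1)) = sum ((\<lambda>i. ?a (i + k0)) \<circ> (\<lambda>j. j - k)) A"
        proof (intro sum.cong refl)
        fix j assume "j \<in> A"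
        then have "j - 1 = (j - k) + k0" using A(2)[of j] by (simp add: k_def)
        then show "?a (j - 1) = ((\<lambda>i. ?a (i + k0)) \<circ> (\<lambda>j. j - k)) j" by simp
      qed
    qed
    also have "\<dots> \<le> (\<Sum>i. ?a (i + k0))"
      using A summable_ignore_initial_segment[OF summ, of k0] by (intro sum_le_suminf a0) auto
    also have "\<dots> \<le> e / 2"
      using k0[of k0] by simp
    finally show ?thesis .
  qed
  have "e / (2 * real k) > 0" using e by (simp add: k_def)
  then obtain m0 where m0: "\<And>m. m \<ge> m0 \<Longrightarrow> \<bar>\<Lambda> m / real m\<bar> < e / (2 * real k)"
    using LIMSEQ_D[OF lim] by (metis diff_zero real_norm_def)
  define m where "m = max m0 k"
  have m: "m \<ge> 1" "m \<ge> k" "\<Lambda> m / real m < e / (2 * real k)"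
    using m0[of m] by (auto simp: m_def k_def intro: le_less_trans[OF abs_ge_self])
  show ?thesis
  proof
    show "m \<ge> 1" by fact
    fix n
    let ?t = "\<lambda>j. \<Lambda> (max j m) / real (max j m) / real (Suc j)"
    have low: "?t j \<le> e / (2 * real k)" for j
    proof -
      have "\<Lambda> (max j m) / real (max j m) \<le> \<Lambda> m / real m"
        using m by (intro mono) auto
      moreover have "?t j \<le> \<Lambda> (max j m) / real (max j m) / 1"
        using pos[of "max j m"] m by (intro divide_left_mono) (auto simp: less_imp_le)
      ultimately show ?thesis using m by simp
    qed
    have "(\<Sum>j\<le>n. ?t j) = (\<Sum>j\<in>{..n} \<inter> {..<k}. ?t j) + (\<Sum>j\<in>{..n} - {..<k}. ?t j)"
      by (subst sum.union_disjoint[symmetric]) (auto intro: sum.cong)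
    also have "(\<Sum>j\<in>{..n} \<inter> {..<k}. ?t j) \<le> e / 2"
    proof -
      have "(\<Sum>j\<in>{..n} \<inter> {..<k}. ?t j) \<le> real (card ({..n} \<inter> {..<k})) * (e / (2 * real k))"
        by (intro sum_bounded_above low)
      also have "\<dots> \<le> real k * (e / (2 * real k))"
        using e card_mono[of "{..<k}" "{..n} \<inter> {..<k}"] by (intro mult_right_mono) auto
      also have "\<dots> = e / 2" by (simp add: k_def field_simps)
      finally show ?thesis .
    qed
    also have "(\<Sum>j\<in>{..n} - {..<k}. ?t j) \<le> (\<Sum>j\<in>{..n} - {..<k}. \<Lambda> j / real j / real (Suc j))"
    proof (intro sum_mono divide_right_mono)
      fix j assume "j \<in> {..n} - {..<k}"
      then show "\<Lambda> (max j m) / real (max j m) \<le> \<Lambda> j / real j"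
        by (intro mono) (auto simp: k_def)
    qed auto
    also have "\<dots> \<le> e / 2"
      by (intro tail) auto
    finally show "(\<Sum>j\<le>n. ?t j) \<le> e" by simp
  qed
qed

section \<open>Variation of periodic functions along grids\<close>

text \<open>Only finite families enter the estimates, so this form keeps them in real arithmetic,
  away from suprema and infinite sums in \<open>ennreal\<close>.\<close>

definition Lambda_variation_le :: "(nat \<Rightarrow> real) \<Rightarrow> real \<Rightarrow> (real \<Rightarrow> real) \<Rightarrow> bool" where
  "Lambda_variation_le \<Lambda> V g \<longleftrightarrow>
     (\<forall>n a b. (\<forall>i\<in>{1..n}. 0 \<le> a i \<and> a i < b i \<and> b i \<le> 2 * pi) \<longrightarrow>
        disjoint_family_on (\<lambda>i. {a i<..<b i}) {1..n} \<longrightarrow>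
        (\<Sum>i=1..n. \<bar>g (b i) - g (a i)\<bar> / \<Lambda> i) \<le> V)"

text \<open>This is the form in which variation meets the cells of the kernel. The starting point is
  any real number, not only one in \<open>torus\<close>, and the bound is unaffected by subtracting
  a constant from \<open>g\<close>.\<close>

definition grid_variation_le :: "(nat \<Rightarrow> real) \<Rightarrow> real \<Rightarrow> (real \<Rightarrow> real) \<Rightarrow> bool" where
  "grid_variation_le \<Lambda> V g \<longleftrightarrow>
     (\<forall>x h n. 0 < h \<longrightarrow> real n * h \<le> 2 * pi \<longrightarrow>
        (\<Sum>i=1..n. \<bar>g (x + real i * h) - g (x + real (i - 1) * h)\<bar> / \<Lambda> i) \<le> V)"

lemma Lambda_variation_leD:
  assumes "Lambda_variation_le \<Lambda> V g"
    and "\<And>i. 1 \<le> i \<Longrightarrow> i \<le> n \<Longrightarrow> 0 \<le> a i \<and> a i < b i \<and> b i \<le> 2 * pi"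
    and "\<And>i j. 1 \<le> i \<Longrightarrow> i < j \<Longrightarrow> j \<le> n \<Longrightarrow> b i \<le> a j \<or> b j \<le> a i"
  shows "(\<Sum>i=1..n. \<bar>g (b i) - g (a i)\<bar> / \<Lambda> i) \<le> V"
proof -
  have "b i \<le> a j \<or> b j \<le> a i" if "i \<in> {1..n}" "j \<in> {1..n}" "i \<noteq> j" for i j
    using assms(3)[of i j] assms(3)[of j i] that by (cases "i < j") auto
  then have "disjoint_family_on (\<lambda>i. {a i<..<b i}) {1..n}"
    unfolding disjoint_family_on_def by fastforce
  then show ?thesis
    using assms(1,2) unfolding Lambda_variation_le_def by simp
qed

text \<open>Serves the quadrants with sign -1: reflection makes a leftward grid increasing, while
  each increment keeps its index and hence its weight.\<close>

lemma Lambda_variation_le_reflect: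
  assumes "Lambda_variation_le \<Lambda> V g"
  shows "Lambda_variation_le \<Lambda> V (\<lambda>x. g (2 * pi - x))"
  unfolding Lambda_variation_le_def
proof (intro allI impI)
  fix n and a b :: "nat \<Rightarrow> real"
  assume ab: "\<forall>i\<in>{1..n}. 0 \<le> a i \<and> a i < b i \<and> b i \<le> 2 * pi"
    and disj: "disjoint_family_on (\<lambda>i. {a i<..<b i}) {1..n}"
  have "disjoint_family_on (\<lambda>i. {2 * pi - b i<..<2 * pi - a i}) {1..n}"
    unfolding disjoint_family_on_def
  proof (intro ballI impI)
    fix i j assume "i \<in> {1..n}" "j \<in> {1..n}" "i \<noteq> j"
    then have "{a i<..<b i} \<inter> {a j<..<b j} = {}"
      using disj by (auto simp: disjoint_family_on_def)
    then have "2 * pi - x \<notin> {a i<..<b i} \<inter> {a j<..<b j}" for x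
      by blast
    moreover have "2 * pi - x \<in> {a i<..<b i}" if "x \<in> {2 * pi - b i<..<2 * pi - a i}" for x i
      using that by auto
    ultimately show "{2 * pi - b i<..<2 * pi - a i} \<inter> {2 * pi - b j<..<2 * pi - a j} = {}"
      by blast
  qed
  then have "(\<Sum>i=1..n. \<bar>g (2 * pi - a i) - g (2 * pi - b i)\<bar> / \<Lambda> i) \<le> V"
    using assms ab unfolding Lambda_variation_le_def by simp
  then show "(\<Sum>i=1..n. \<bar>g (2 * pi - b i) - g (2 * pi - a i)\<bar> / \<Lambda> i) \<le> V"
    by (simp add: abs_minus_commute)
qed

lemma periodic_shift_int:
  fixes g :: "real \<Rightarrow> 'a"
  assumes "\<And>x. g (x + 2 * pi) = g x"
  shows "g (x + 2 * pi * of_int k) = g x"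
proof -
  have nat: "g (x + 2 * pi * real n) = g x" for x n
  proof (induction n)
    case (Suc n)
    then show ?case using assms[of "x + 2 * pi * real n"] by (simp add: algebra_simps)
  qed simp
  show ?thesis
  proof (cases "k \<ge> 0")
    case True
    then show ?thesis using nat[of x "nat k"] by simp
  next
    case False
    then show ?thesis using nat[of "x + 2 * pi * of_int k" "nat (- k)"] by (simp add: algebra_simps)
  qed
qed

lemma period_representative:
  obtains k :: int where "x - 2 * pi * of_int k \<in> {0..<2 * pi}"
proof -
  define k where "k = \<lfloor>x / (2 * pi)\<rfloor>"
  have "of_int k \<le> x / (2 * pi)" "x / (2 * pi) < of_int k + 1"
    unfolding k_def by linarith+
  then have "x - 2 * pi * of_int k \<in> {0..<2 * pi}"
    by (auto simp: pos_le_divide_eq pos_divide_less_eq algebra_simps)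
  then show thesis by (rule that)
qed

text \<open>The factor 2 comes from the one interval that may straddle a multiple of \<open>2\<pi>\<close>: its two halves
  are accounted for by two different families of intervals.\<close>
lemma periodic_increments_le:
  fixes g :: "real \<Rightarrow> real" and u :: "nat \<Rightarrow> real"
  assumes pos: "\<And>j. j \<ge> 1 \<Longrightarrow> \<Lambda> j > 0"
    and var: "Lambda_variation_le \<Lambda> V g"
    and per: "\<And>x. g (x + 2 * pi) = g x"
    and u: "strict_mono u" and un: "u n - u 0 \<le> 2 * pi"
  shows "(\<Sum>i=1..n. \<bar>g (u i) - g (u (i - 1))\<bar> / \<Lambda> i) \<le> 2 * V"
proof -
  have V0: "V \<ge> 0"
    using Lambda_variation_leD[OF var, of 0] by simp
  obtain k :: int where k: "u 0 - 2 * pi * of_int k \<in> {0..<2 * pi}"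
    by (rule period_representative)
  define v where "v i = u i - 2 * pi * of_int k" for i
  have gv: "g (v i) = g (u i)" for i
    using periodic_shift_int[of g, OF per, of "v i" k] by (simp add: v_def)
  have v0: "0 \<le> v 0" "v 0 < 2 * pi"
    using k by (auto simp: v_def)
  have vn: "v n \<le> v 0 + 2 * pi"
    using un by (simp add: v_def)
  have less: "v i < v j \<longleftrightarrow> i < j" and le: "v i \<le> v j \<longleftrightarrow> i \<le> j" for i j
    using u by (simp_all add: v_def strict_mono_less strict_mono_less_eq)
  have step: "v i \<le> v (j - 1)" if "i < j" for i j
    using that by (simp add: le)
  have gap: "v (i - 1) < v i" if "1 \<le> i" for i
    using that by (simp add: less)
  show ?thesis
  proof (cases "v n \<le> 2 * pi")
    case True
    have "(\<Sum>i=1..n. \<bar>g (v i) - g (v (i - 1))\<bar> / \<Lambda> i) \<le> V"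
    proof (rule Lambda_variation_leD[OF var])
      fix i assume "1 \<le> i" "i \<le> n"
      then show "0 \<le> v (i - 1) \<and> v (i - 1) < v i \<and> v i \<le> 2 * pi"
        using gap[of i] v0 le[of 0 "i - 1"] le[of i n] True by linarith
    qed (use step in auto)
    then show ?thesis using V0 by (simp add: gv)
  next
    case False
    define r where "r = (LEAST i. v i > 2 * pi)"
    have vr: "v r > 2 * pi"
      unfolding r_def by (rule LeastI[of _ n]) (use False in simp)
    have rn: "r \<le> n"
      unfolding r_def by (rule Least_le) (use False in simp)
    have r1: "r \<ge> 1"
      using vr v0 by (cases "r = 0") auto
    have below: "v i \<le> 2 * pi" if "i < r" for i
      using not_less_Least[of i "\<lambda>i. v i > 2 * pi"] that unfolding r_def by linarith
    \<comment> \<open>Interval \<open>r\<close> is the one that reaches past 2 pi. This family keeps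
      its right part, moved back to start at 0, and moves all later intervals back by one period.
      They end no later than \<open>v 0\<close>, since the whole grid spans at most one period, so
      they do not meet the intervals before \<open>r\<close>.\<close>
    define a where "a i = (if i < r then v (i - 1) else if i = r then 0 else v (i - 1) - 2 * pi)" for i
    define b where "b i = (if i < r then v i else v i - 2 * pi)" for i
    have "(\<Sum>i=1..n. \<bar>g (b i) - g (a i)\<bar> / \<Lambda> i) \<le> V"
    proof (rule Lambda_variation_leD[OF var])
      fix i assume i: "1 \<le> i" "i \<le> n"
      have "v r \<le> v (i - 1)" if "i > r"
        using that by (rule step)
      then show "0 \<le> a i \<and> a i < b i \<and> b i \<le> 2 * pi"
        using gap[OF i(1)] v0 le[of 0 "i - 1"] below[of i] vr le[of i n] i vn
        unfolding a_def b_def by auto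
    next
      fix i j assume ij: "1 \<le> i" "i < j" "j \<le> n"
      show "b i \<le> a j \<or> b j \<le> a i"
        using step[OF ij(2)] le[of j n] ij vn le[of 0 "i - 1"] unfolding a_def b_def by auto
    qed
    moreover have "\<bar>g (2 * pi) - g (v (r - 1))\<bar> / \<Lambda> r \<le> V"
    \<comment> \<open>If the grid hits 2 pi exactly, the left part of interval \<open>r\<close> is
      empty and contributes 0.\<close>
    proof (cases "v (r - 1) = 2 * pi")
      case False
      then have lt: "v (r - 1) < 2 * pi"
        using below[of "r - 1"] r1 by simp
      \<comment> \<open>The left part must keep the weight of index \<open>r\<close>, and no index
        may be skipped. The earlier grid intervals therefore fill the places before
        \<open>r\<close>; their nonnegative terms only enlarge the sum.\<close>
      let ?b = "\<lambda>i. if i = r then 2 * pi else v i"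
      have "\<bar>g (2 * pi) - g (v (r - 1))\<bar> / \<Lambda> r = (\<Sum>i\<in>{r}. \<bar>g (?b i) - g (v (i - 1))\<bar> / \<Lambda> i)"
        by simp
      also have "\<dots> \<le> (\<Sum>i=1..r. \<bar>g (?b i) - g (v (i - 1))\<bar> / \<Lambda> i)"
        using r1 pos by (intro sum_mono2) (auto simp: less_imp_le)
      also have "\<dots> \<le> V"
      proof (rule Lambda_variation_leD[OF var])
        fix i assume i: "1 \<le> i" "i \<le> r"
        show "0 \<le> v (i - 1) \<and> v (i - 1) < ?b i \<and> ?b i \<le> 2 * pi"
          using gap[OF i(1)] v0 le[of 0 "i - 1"] below[of i] i lt by auto
      next
        fix i j assume "1 \<le> i" "i < j" "j \<le> r"
        then show "?b i \<le> v (j - 1) \<or> ?b j \<le> v (i - 1)"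
          using step[of i j] by auto
      qed
      finally show ?thesis .
    qed (use V0 in simp)
    moreover have "(\<Sum>i=1..n. \<bar>g (v i) - g (v (i - 1))\<bar> / \<Lambda> i)
      \<le> (\<Sum>i=1..n. \<bar>g (b i) - g (a i)\<bar> / \<Lambda> i + (if i = r then \<bar>g (2 * pi) - g (v (r - 1))\<bar> / \<Lambda> r else 0))"
    proof (rule sum_mono)
      fix i assume i: "i \<in> {1..n}"
      have shift: "g (x - 2 * pi) = g x" for x
        using per[of "x - 2 * pi"] by simp
      have "\<bar>g (v i) - g (v (i - 1))\<bar>
        \<le> \<bar>g (b i) - g (a i)\<bar> + (if i = r then \<bar>g (2 * pi) - g (v (r - 1))\<bar> else 0)"
        using shift[of "2 * pi"] by (auto simp: a_def b_def shift)
      then have "\<bar>g (v i) - g (v (i - 1))\<bar> / \<Lambda> i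
        \<le> (\<bar>g (b i) - g (a i)\<bar> + (if i = r then \<bar>g (2 * pi) - g (v (r - 1))\<bar> else 0)) / \<Lambda> i"
        using pos[of i] i by (intro divide_right_mono) (auto simp: less_imp_le)
      then show "\<bar>g (v i) - g (v (i - 1))\<bar> / \<Lambda> i \<le> \<bar>g (b i) - g (a i)\<bar> / \<Lambda> i
          + (if i = r then \<bar>g (2 * pi) - g (v (r - 1))\<bar> / \<Lambda> r else 0)"
        by (auto simp: add_divide_distrib)
    qed
    ultimately have "(\<Sum>i=1..n. \<bar>g (v i) - g (v (i - 1))\<bar> / \<Lambda> i) \<le> V + V"
      using rn r1 by (simp add: sum.distrib)
    then show ?thesis by (simp add: gv)
  qed
qed

lemma grid_variation_le_of_Lambda_variation:
  assumes pos: "\<And>j. j \<ge> 1 \<Longrightarrow> \<Lambda> j > 0"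
    and var: "Lambda_variation_le \<Lambda> V g"
    and per: "\<And>x. g (x + 2 * pi) = g x"
    and \<sigma>: "\<sigma> = 1 \<or> \<sigma> = -1"
  shows "grid_variation_le \<Lambda> (2 * V) (\<lambda>s. g (x + \<sigma> * s))"
  unfolding grid_variation_le_def
proof (intro allI impI)
  fix s h :: real and n :: nat
  assume h: "0 < h" and nh: "real n * h \<le> 2 * pi"
  show "(\<Sum>i=1..n. \<bar>g (x + \<sigma> * (s + real i * h)) - g (x + \<sigma> * (s + real (i - 1) * h))\<bar> / \<Lambda> i) \<le> 2 * V"
    using \<sigma>
  proof
    assume \<sigma>: "\<sigma> = 1"
    show ?thesis
      using periodic_increments_le[OF pos var per, of "\<lambda>i. x + (s + real i * h)" n] h nh
      by (simp add: \<sigma> strict_mono_def)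
  next
    assume \<sigma>: "\<sigma> = -1"
    \<comment> \<open>The reflected function has the same period, and under the reflection
      \<open>x - s\<close> corresponds to \<open>2 * pi - x + s\<close>, which increases with
      \<open>s\<close>.\<close>
    have "g (2 * pi - (z + 2 * pi)) = g (2 * pi - z)" for z
      using per[of "- z"] by (simp add: algebra_simps)
    then show ?thesis
      using periodic_increments_le[OF pos Lambda_variation_le_reflect[OF var],
          of "\<lambda>i. 2 * pi - x + (s + real i * h)" n] h nh
      by (simp add: \<sigma> strict_mono_def algebra_simps)
  qed
qed

section \<open>Variation bounds for all sections, and boundedness of the function\<close>

lemma infsum_ennreal_le_imp_sum_le:
  fixes t :: "nat \<Rightarrow> real"
  assumes "(\<Sum>\<^sub>\<infinity>i\<in>{1..n}. ennreal (t i)) \<le> ennreal V" "V \<ge> 0" "\<And>i. i \<in> {1..n} \<Longrightarrow> t i \<ge> 0"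
  shows "(\<Sum>i=1..n. t i) \<le> V"
proof -
  have "ennreal (\<Sum>i=1..n. t i) \<le> ennreal V"
    using assms(1) sum_ennreal[of "{1..n}" t, OF assms(3)] by (simp del: One_nat_def)
  then show ?thesis using assms(2) by (simp add: ennreal_le_iff)
qed

lemma PLambdaBV_Lambda_variation_le:
  assumes pos: "\<And>j. j \<ge> 1 \<Longrightarrow> \<Lambda> j > 0" and f: "f \<in> PLambdaBV \<Lambda>"
  obtains V where "V \<ge> 0" "\<And>y. y \<in> torus \<Longrightarrow> Lambda_variation_le \<Lambda> V (\<lambda>x. f (x, y))"
    "\<And>x. x \<in> torus \<Longrightarrow> Lambda_variation_le \<Lambda> V (\<lambda>y. f (x, y))"
proof -
  define W where "W = Lambda_V1 \<Lambda> f + Lambda_V2 \<Lambda> f"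
  have W: "W < \<infinity>"
    using f by (simp add: PLambdaBV_def W_def)
  define V where "V = enn2real W"
  have V: "V \<ge> 0" "ennreal V = W"
    using W by (auto simp: V_def)
  show ?thesis
  proof
    show "V \<ge> 0" by fact
  next
    fix y assume y: "y \<in> torus"
    show "Lambda_variation_le \<Lambda> V (\<lambda>x. f (x, y))"
      unfolding Lambda_variation_le_def
    proof (intro allI impI)
      fix n and a b :: "nat \<Rightarrow> real"
      assume "\<forall>i\<in>{1..n}. 0 \<le> a i \<and> a i < b i \<and> b i \<le> 2 * pi"
        and "disjoint_family_on (\<lambda>i. {a i<..<b i}) {1..n}"
      then have mem: "({1..n}, \<lambda>i. (a i, b i)) \<in> ordered_intervals"
        unfolding ordered_intervals_def by auto
      have "(\<Sum>\<^sub>\<infinity>i\<in>{1..n}. ennreal (\<bar>f (b i, y) - f (a i, y)\<bar> / \<Lambda> i)) \<le> Lambda_V1 \<Lambda> f"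
        unfolding Lambda_V1_def by (rule SUP_upper2[OF y], rule SUP_upper2[OF mem]) simp
      also have "\<dots> \<le> ennreal V" unfolding V W_def by simp
      finally show "(\<Sum>i=1..n. \<bar>f (b i, y) - f (a i, y)\<bar> / \<Lambda> i) \<le> V"
        by (rule infsum_ennreal_le_imp_sum_le) (use V pos in \<open>auto simp: less_imp_le\<close>)
    qed
  next
    fix x assume x: "x \<in> torus"
    show "Lambda_variation_le \<Lambda> V (\<lambda>y. f (x, y))"
      unfolding Lambda_variation_le_def
    proof (intro allI impI)
      fix n and a b :: "nat \<Rightarrow> real"
      assume "\<forall>i\<in>{1..n}. 0 \<le> a i \<and> a i < b i \<and> b i \<le> 2 * pi"
        and "disjoint_family_on (\<lambda>i. {a i<..<b i}) {1..n}"
      then have mem: "({1..n}, \<lambda>i. (a i, b i)) \<in> ordered_intervals"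
        unfolding ordered_intervals_def by auto
      have "(\<Sum>\<^sub>\<infinity>i\<in>{1..n}. ennreal (\<bar>f (x, b i) - f (x, a i)\<bar> / \<Lambda> i)) \<le> Lambda_V2 \<Lambda> f"
        unfolding Lambda_V2_def by (rule SUP_upper2[OF x], rule SUP_upper2[OF mem]) simp
      also have "\<dots> \<le> ennreal V" unfolding V W_def by simp
      finally show "(\<Sum>i=1..n. \<bar>f (x, b i) - f (x, a i)\<bar> / \<Lambda> i) \<le> V"
        by (rule infsum_ennreal_le_imp_sum_le) (use V pos in \<open>auto simp: less_imp_le\<close>)
    qed
  qed
qed

text \<open>Periodicity carries the bounds from the sections over \<open>torus\<close> to those over
  all parallel lines. The constant doubles because of an interval that may cross a multiple of the
  period.\<close>

lemma PLambdaBV_grid_variation_le: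
  fixes f :: "real \<times> real \<Rightarrow> real"
  assumes pos: "\<And>j. j \<ge> 1 \<Longrightarrow> \<Lambda> j > 0" and f: "f \<in> PLambdaBV \<Lambda>"
    and per1: "\<And>x y. f (x + 2 * pi, y) = f (x, y)"
    and per2: "\<And>x y. f (x, y + 2 * pi) = f (x, y)"
  obtains V where "V \<ge> 0"
    "\<And>\<sigma> x y. \<sigma> = 1 \<or> \<sigma> = -1 \<Longrightarrow> grid_variation_le \<Lambda> V (\<lambda>s. f (x + \<sigma> * s, y))"
    "\<And>\<tau> x y. \<tau> = 1 \<or> \<tau> = -1 \<Longrightarrow> grid_variation_le \<Lambda> V (\<lambda>t. f (x, y + \<tau> * t))"
proof -
  obtain V where V: "V \<ge> 0" "\<And>y. y \<in> torus \<Longrightarrow> Lambda_variation_le \<Lambda> V (\<lambda>x. f (x, y))"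
    "\<And>x. x \<in> torus \<Longrightarrow> Lambda_variation_le \<Lambda> V (\<lambda>y. f (x, y))"
    using PLambdaBV_Lambda_variation_le[OF pos f] by blast
  have V1: "Lambda_variation_le \<Lambda> V (\<lambda>x. f (x, y))" for y
  proof -
    obtain k :: int where k: "y - 2 * pi * of_int k \<in> {0..<2 * pi}"
      by (rule period_representative)
    have "(\<lambda>x. f (x, y - 2 * pi * of_int k)) = (\<lambda>x. f (x, y))"
      using periodic_shift_int[of "\<lambda>y. f (_, y)", OF per2, of _ "y - 2 * pi * of_int k" k] by auto
    then show ?thesis using V(2)[of "y - 2 * pi * of_int k"] k by auto
  qed
  have V2: "Lambda_variation_le \<Lambda> V (\<lambda>y. f (x, y))" for x
  proof -
    obtain k :: int where k: "x - 2 * pi * of_int k \<in> {0..<2 * pi}"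
      by (rule period_representative)
    have "(\<lambda>y. f (x - 2 * pi * of_int k, y)) = (\<lambda>y. f (x, y))"
      using periodic_shift_int[of "\<lambda>x. f (x, _)", OF per1, of "x - 2 * pi * of_int k" k] by auto
    then show ?thesis using V(3)[of "x - 2 * pi * of_int k"] k by auto
  qed
  show ?thesis
  proof
    show "2 * V \<ge> 0" using V by simp
    show "grid_variation_le \<Lambda> (2 * V) (\<lambda>s. f (x + \<sigma> * s, y))" if "\<sigma> = 1 \<or> \<sigma> = -1" for \<sigma> x y
      by (rule grid_variation_le_of_Lambda_variation[OF pos V1 per1 that])
    show "grid_variation_le \<Lambda> (2 * V) (\<lambda>t. f (x, y + \<tau> * t))" if "\<tau> = 1 \<or> \<tau> = -1" for \<tau> x y
      by (rule grid_variation_le_of_Lambda_variation[OF pos V2 per2 that])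
  qed
qed

text \<open>A single step whose length is the distance of the two points is a grid with one
  increment, which carries the weight of index 1.\<close>

lemma grid_variation_le_oscillation:
  assumes "grid_variation_le \<Lambda> V g" "\<Lambda> 1 > 0" "\<bar>x - y\<bar> \<le> 2 * pi"
  shows "\<bar>g x - g y\<bar> \<le> V * \<Lambda> 1"
proof -
  have *: "\<bar>g (x + h) - g x\<bar> \<le> V * \<Lambda> 1" if "0 < h" "h \<le> 2 * pi" for x h
  proof -
    have "(\<Sum>i=1..1. \<bar>g (x + real i * h) - g (x + real (i - 1) * h)\<bar> / \<Lambda> i) \<le> V"
      using assms(1)[unfolded grid_variation_le_def, rule_format, of h 1 x] that by simp
    then show ?thesis using assms(2) by (simp add: field_simps)
  qed
  have "V \<ge> 0"
    using assms(1)[unfolded grid_variation_le_def, rule_format, of 1 0] by simp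
  consider "x = y" | "x < y" | "y < x" by linarith
  then show ?thesis
  proof cases
    case 1
    then show ?thesis using \<open>V \<ge> 0\<close> assms(2) by simp
  next
    case 2
    then show ?thesis using *[of "y - x" x] assms(3) by (simp add: abs_minus_commute)
  next
    case 3
    then show ?thesis using *[of "x - y" y] assms(3) by simp
  qed
qed

text \<open>The representative of \<open>p\<close> in the basic square is reached from the origin
  along two axis-parallel segments, each changing \<open>f\<close> by at most
  \<open>V * \<Lambda> 1\<close>. Boundedness makes later integrands integrable on bounded sets as
  soon as they are measurable.\<close>

lemma periodic_grid_variation_bounded:
  fixes f :: "real \<times> real \<Rightarrow> real"
  assumes \<Lambda>: "\<Lambda> 1 > 0"
    and per1: "\<And>x y. f (x + 2 * pi, y) = f (x, y)"
    and per2: "\<And>x y. f (x, y + 2 * pi) = f (x, y)"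
    and V1: "\<And>y. grid_variation_le \<Lambda> V (\<lambda>s. f (s, y))"
    and V2: "\<And>x. grid_variation_le \<Lambda> V (\<lambda>t. f (x, t))"
  shows "\<bar>f p\<bar> \<le> \<bar>f (0, 0)\<bar> + 2 * V * \<Lambda> 1"
proof (cases p)
  case (Pair x y)
  obtain k :: int where k: "x - 2 * pi * of_int k \<in> {0..<2 * pi}"
    by (rule period_representative)
  obtain l :: int where l: "y - 2 * pi * of_int l \<in> {0..<2 * pi}"
    by (rule period_representative)
  define x' where "x' = x - 2 * pi * of_int k"
  define y' where "y' = y - 2 * pi * of_int l"
  have "f (x, y) = f (x', y')"
    using periodic_shift_int[of "\<lambda>x. f (x, y)", OF per1, of x' k]
      periodic_shift_int[of "\<lambda>y. f (x', y)", OF per2, of y' l] by (simp add: x'_def y'_def)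
  moreover have "\<bar>f (x', y') - f (0, y')\<bar> \<le> V * \<Lambda> 1"
    using grid_variation_le_oscillation[OF V1 \<Lambda>, of x' 0] k by (simp add: x'_def)
  moreover have "\<bar>f (0, y') - f (0, 0)\<bar> \<le> V * \<Lambda> 1"
    using grid_variation_le_oscillation[OF V2 \<Lambda>, of y' 0] l by (simp add: y'_def)
  ultimately show ?thesis using Pair by simp
qed

section \<open>Integration over boxes in the plane\<close>

definition reflect_shift :: "real \<Rightarrow> real \<Rightarrow> real \<Rightarrow> real \<Rightarrow> real \<times> real \<Rightarrow> real \<times> real" where
  "reflect_shift \<sigma> \<tau> x y p = (x + \<sigma> * fst p, y + \<tau> * snd p)"

text \<open>The map is affine with diagonal coefficients of modulus one, so it respects the
  completed sigma-algebra and preserves the measure. Each quadrant at \<open>(x, y)\<close> can thus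
  be moved to the standard one.\<close>

lemma
  assumes \<sigma>: "\<bar>\<sigma>\<bar> = 1" and \<tau>: "\<bar>\<tau>\<bar> = 1"
  shows measurable_reflect_shift [measurable]: "reflect_shift \<sigma> \<tau> x y \<in> lebesgue \<rightarrow>\<^sub>M lebesgue"
    and distr_reflect_shift: "distr lebesgue lebesgue (reflect_shift \<sigma> \<tau> x y) = lebesgue"
proof -
  let ?c = "\<lambda>j::real \<times> real. if j = (1, 0) then \<sigma> else \<tau>"
  have c0: "?c j \<noteq> 0" for j using \<sigma> \<tau> by auto
  have eq: "reflect_shift \<sigma> \<tau> x y = (\<lambda>p. (x, y) + (\<Sum>j\<in>Basis. (?c j * (p \<bullet> j)) *\<^sub>R j))"
    by (auto simp: fun_eq_iff sum_Basis_prod_eq reflect_shift_def)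
  show "reflect_shift \<sigma> \<tau> x y \<in> lebesgue \<rightarrow>\<^sub>M lebesgue"
    unfolding eq by (rule lebesgue_affine_measurable[OF c0])
  have "(\<Prod>j\<in>Basis. \<bar>?c j\<bar>) = 1"
    using \<sigma> \<tau> by (intro prod.neutral) auto
  then show "distr lebesgue lebesgue (reflect_shift \<sigma> \<tau> x y) = lebesgue"
    unfolding eq using lebesgue_affine_euclidean[of ?c "(x, y)", OF c0] by (simp add: density_1)
qed

lemma integral_reflect_shift:
  fixes F :: "real \<times> real \<Rightarrow> 'b::{banach, second_countable_topology}"
  assumes "\<bar>\<sigma>\<bar> = 1" "\<bar>\<tau>\<bar> = 1" "F \<in> borel_measurable lebesgue"
  shows "integral\<^sup>L lebesgue (\<lambda>p. F (reflect_shift \<sigma> \<tau> x y p)) = integral\<^sup>L lebesgue F"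
  using integral_distr[OF measurable_reflect_shift[OF assms(1,2)] assms(3), of x y]
  by (simp add: distr_reflect_shift[OF assms(1,2)])

text \<open>Axis-parallel lines are null; this and its twin for \<open>snd\<close> allow edges of
  cells, boxes and quadrants to be ignored.\<close>

lemma AE_fst_neq: "AE p in (lebesgue :: (real \<times> real) measure). fst p \<noteq> c"
proof -
  have "negligible {p :: real \<times> real. p \<bullet> (1, 0) = c}"
    by (rule negligible_standard_hyperplane) (simp add: Basis_prod_def)
  then have "AE p in lebesgue. p \<notin> {p :: real \<times> real. p \<bullet> (1, 0) = c}"
    by (intro AE_not_in) (simp add: negligible_iff_null_sets)
  then show ?thesis by eventually_elim (auto simp: inner_prod_def)
qed

lemma AE_snd_neq: "AE p in (lebesgue :: (real \<times> real) measure). snd p \<noteq> c"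
proof -
  have "negligible {p :: real \<times> real. p \<bullet> (0, 1) = c}"
    by (rule negligible_standard_hyperplane) (simp add: Basis_prod_def)
  then have "AE p in lebesgue. p \<notin> {p :: real \<times> real. p \<bullet> (0, 1) = c}"
    by (intro AE_not_in) (simp add: negligible_iff_null_sets)
  then show ?thesis by eventually_elim (auto simp: inner_prod_def)
qed

lemma bounded_set_integrable:
  fixes F :: "real \<times> real \<Rightarrow> 'b::{banach, second_countable_topology}"
  assumes "F \<in> borel_measurable lebesgue" "\<And>p. norm (F p) \<le> B" "A \<in> sets borel" "bounded A"
  shows "set_integrable lebesgue A F"
proof -
  have "emeasure lborel A < \<infinity>"
    using assms(4) by (rule emeasure_bounded_finite)
  then show ?thesis
    unfolding set_integrable_def using assms
    by (intro integrableI_bounded_set_indicator[where B = B]) auto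
qed

section \<open>Translating and folding planar integrals\<close>

lemma set_integral_shift:
  fixes H :: "real \<times> real \<Rightarrow> 'b::{banach, second_countable_topology}"
  assumes [measurable]: "H \<in> borel_measurable lebesgue" "S \<in> sets borel"
    and H: "\<And>p. H (p + v) = H p"
  shows "set_lebesgue_integral lebesgue S H = set_lebesgue_integral lebesgue {p. p + v \<in> S} H"
proof -
  have [measurable]: "S \<in> sets lebesgue"
    using assms(2) by auto
  have "integral\<^sup>L lebesgue (\<lambda>p. indicator S (reflect_shift 1 1 (fst v) (snd v) p) *\<^sub>R H (reflect_shift 1 1 (fst v) (snd v) p))
    = integral\<^sup>L lebesgue (\<lambda>p. indicator S p *\<^sub>R H p)"
    by (rule integral_reflect_shift[where F = "\<lambda>p. indicator S p *\<^sub>R H p"]) (simp_all, measurable)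
  moreover have "reflect_shift 1 1 (fst v) (snd v) p = p + v" for p
    by (simp add: reflect_shift_def prod_eq_iff)
  ultimately show ?thesis
    by (simp add: set_lebesgue_integral_def H indicator_def)
qed

text \<open>The interval of one period is cut at the multiple of 2 pi it contains, and the two
  pieces are translated by \<open>k\<close> and \<open>k + 1\<close> periods to fill the basic
  interval. The parameter \<open>A\<close> treats both coordinate directions in one proof; using
  strips in the plane avoids iterated integrals.\<close>

lemma set_integral_period:
  fixes H :: "real \<times> real \<Rightarrow> real" and A :: "real set \<Rightarrow> (real \<times> real) set"
  assumes A: "A = (\<lambda>S. S \<times> {c..<d}) \<and> e = (1, 0) \<or> A = (\<lambda>S. {c..<d} \<times> S) \<and> e = (0, 1)"
    and H [measurable]: "H \<in> borel_measurable lebesgue" and B: "\<And>p. \<bar>H p\<bar> \<le> B"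
    and per: "\<And>p k. H (p + (2 * pi * of_int k) *\<^sub>R e) = H p"
  shows "set_lebesgue_integral lebesgue (A {a..<a + 2 * pi}) H = set_lebesgue_integral lebesgue (A {0..<2 * pi}) H"
proof -
  obtain k :: int where k: "a - 2 * pi * of_int k \<in> {0..<2 * pi}"
    by (rule period_representative)
  define z where "z = 2 * pi * of_int k"
  have a: "z \<le> a" "a < z + 2 * pi"
    using k by (auto simp: z_def)
  have meas: "A {u..<v} \<in> sets borel" for u v
    using A by (auto intro!: borel_Times)
  have bdd: "bounded (A {u..<v})" for u v
    using A by (auto intro!: bounded_Times)
  have int: "set_integrable lebesgue (A {u..<v}) H" for u v
    by (rule bounded_set_integrable[OF H _ meas bdd, where B = B]) (simp add: B)
  have split: "set_lebesgue_integral lebesgue (A {u..<w}) H =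
      set_lebesgue_integral lebesgue (A {u..<v}) H + set_lebesgue_integral lebesgue (A {v..<w}) H"
    if "u \<le> v" "v \<le> w" for u v w
  proof -
    have "A {u..<w} = A {u..<v} \<union> A {v..<w}" "A {u..<v} \<inter> A {v..<w} = {}"
      using A that by auto
    then show ?thesis by (simp add: set_integral_Un int)
  qed
  have shift: "set_lebesgue_integral lebesgue (A {u..<v}) H =
      set_lebesgue_integral lebesgue (A {u - 2 * pi * of_int k..<v - 2 * pi * of_int k}) H" for u v k
  proof -
    have "{p. p + (2 * pi * of_int k) *\<^sub>R e \<in> A {u..<v}} = A {u - 2 * pi * of_int k..<v - 2 * pi * of_int k}"
      using A by auto
    then show ?thesis
      using set_integral_shift[OF H meas per, of u v k] by simp
  qed
  have "set_lebesgue_integral lebesgue (A {a..<a + 2 * pi}) H =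
      set_lebesgue_integral lebesgue (A {a..<z + 2 * pi}) H + set_lebesgue_integral lebesgue (A {z + 2 * pi..<a + 2 * pi}) H"
    using a by (intro split) auto
  also have "\<dots> = set_lebesgue_integral lebesgue (A {a - z..<2 * pi}) H + set_lebesgue_integral lebesgue (A {0..<a - z}) H"
    using shift[of a "z + 2 * pi" k] shift[of "z + 2 * pi" "a + 2 * pi" "k + 1"]
    by (simp add: z_def algebra_simps)
  also have "\<dots> = set_lebesgue_integral lebesgue (A {0..<2 * pi}) H"
    using a by (subst split[of 0 "a - z" "2 * pi"]) auto
  finally show ?thesis .
qed

lemma integral_torus_eq_shifted_box:
  fixes H :: "real \<times> real \<Rightarrow> real"
  assumes H [measurable]: "H \<in> borel_measurable lebesgue" and B: "\<And>p. \<bar>H p\<bar> \<le> B"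
    and per1: "\<And>x y k. H (x + 2 * pi * of_int k, y) = H (x, y)"
    and per2: "\<And>x y k. H (x, y + 2 * pi * of_int k) = H (x, y)"
  shows "set_lebesgue_integral lebesgue (torus \<times> torus) H =
    set_lebesgue_integral lebesgue ({x - pi..<x + pi} \<times> {y - pi..<y + pi}) H"
proof -
  have [measurable]: "torus \<times> torus \<in> sets lebesgue" "{0..<2 * pi} \<times> {0..<2 * pi} \<in> sets lebesgue"
    by (auto simp: borel_Times)
  have "set_lebesgue_integral lebesgue (torus \<times> torus) H =
      set_lebesgue_integral lebesgue ({0..<2 * pi} \<times> {0..<2 * pi}) H"
    unfolding set_lebesgue_integral_def
  proof (rule integral_cong_AE)
    \<comment> \<open>The closed and the half-open square differ only on the two lines at 2
      pi.\<close>
    show "AE p in lebesgue. indicat_real (torus \<times> torus) p *\<^sub>R H p =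
        indicat_real ({0..<2 * pi} \<times> {0..<2 * pi}) p *\<^sub>R H p"
      using AE_fst_neq[of "2 * pi"] AE_snd_neq[of "2 * pi"]
      by eventually_elim (auto simp: indicator_def)
  qed measurable
  also have "\<dots> = set_lebesgue_integral lebesgue ({x - pi..<x + pi} \<times> {0..<2 * pi}) H"
    using set_integral_period[OF _ H B, of "\<lambda>S. S \<times> {0..<2 * pi}" 0 "2 * pi" "(1, 0)" "x - pi"] per1
    by (auto simp: algebra_simps)
  also have "\<dots> = set_lebesgue_integral lebesgue ({x - pi..<x + pi} \<times> {y - pi..<y + pi}) H"
    using set_integral_period[OF _ H B, of "\<lambda>S. {x - pi..<x + pi} \<times> S" "x - pi" "x + pi" "(0, 1)" "y - pi"] per2
    by (auto simp: algebra_simps)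
  finally show ?thesis .
qed

text \<open>Off finitely many axis-parallel lines, the indicators of the four reflected copies of
  the standard quadrant add up to that of the box. Each copy is then pulled back by its
  \<open>reflect_shift\<close>.\<close>

lemma integral_box_eq_quadrants:
  fixes H :: "real \<times> real \<Rightarrow> real"
  assumes H [measurable]: "H \<in> borel_measurable lebesgue" and B: "\<And>p. \<bar>H p\<bar> \<le> B"
  shows "set_lebesgue_integral lebesgue ({x - pi..<x + pi} \<times> {y - pi..<y + pi}) H =
    (\<Sum>\<sigma>\<in>{1,-1}. \<Sum>\<tau>\<in>{1,-1}.
       set_lebesgue_integral lebesgue ({0..pi} \<times> {0..pi}) (\<lambda>p. H (reflect_shift \<sigma> \<tau> x y p)))"
proof -
  let ?Q = "{0..pi} \<times> {0..pi}"
  \<comment> \<open>For signs 1 and -1 this is the inverse of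
    \<open>reflect_shift \<sigma> \<tau> x y\<close>.\<close>
  let ?r = "\<lambda>\<sigma> \<tau> p. reflect_shift \<sigma> \<tau> (- \<sigma> * x) (- \<tau> * y) p"
  let ?G = "\<lambda>\<sigma> \<tau> p. indicat_real ?Q (?r \<sigma> \<tau> p) *\<^sub>R H p"
  have [measurable]: "?Q \<in> sets lebesgue" "{x - pi..<x + pi} \<times> {y - pi..<y + pi} \<in> sets lebesgue"
    by (auto simp: borel_Times)
  have inv: "?r \<sigma> \<tau> (reflect_shift \<sigma> \<tau> x y p) = p" if "\<sigma> \<in> {1,-1}" "\<tau> \<in> {1,-1}" for \<sigma> \<tau> p
    using that by (auto simp: reflect_shift_def)
  have G_meas [measurable]: "?G \<sigma> \<tau> \<in> borel_measurable lebesgue" if "\<sigma> \<in> {1,-1}" "\<tau> \<in> {1,-1}" for \<sigma> \<tau>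
  proof -
    have "\<bar>\<sigma>\<bar> = 1" "\<bar>\<tau>\<bar> = 1" using that by auto
    then have [measurable]: "?r \<sigma> \<tau> \<in> lebesgue \<rightarrow>\<^sub>M lebesgue"
      by (rule measurable_reflect_shift)
    show ?thesis by measurable
  qed
  have G_int: "integrable lebesgue (?G \<sigma> \<tau>)" if "\<sigma> \<in> {1,-1}" "\<tau> \<in> {1,-1}" for \<sigma> \<tau>
  proof (rule integrableI_bounded_set[where A = "cbox (x - pi, y - pi) (x + pi, y + pi)" and B = B])
    show "AE p in lebesgue. p \<notin> cbox (x - pi, y - pi) (x + pi, y + pi) \<longrightarrow> ?G \<sigma> \<tau> p = 0"
      using that by (intro always_eventually) (auto simp: reflect_shift_def cbox_Pair_eq mem_Times_iff)
    have "\<bar>?G \<sigma> \<tau> p\<bar> \<le> B" for p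
      using B[of p] by (auto simp: indicator_def)
    then show "AE p in lebesgue. p \<in> cbox (x - pi, y - pi) (x + pi, y + pi) \<longrightarrow> norm (?G \<sigma> \<tau> p) \<le> B"
      by simp
  qed (use G_meas[OF that] in \<open>auto simp: emeasure_lborel_cbox_eq\<close>)
  have "set_lebesgue_integral lebesgue ({x - pi..<x + pi} \<times> {y - pi..<y + pi}) H =
      integral\<^sup>L lebesgue (\<lambda>p. \<Sum>\<sigma>\<in>{1,-1}. \<Sum>\<tau>\<in>{1,-1}. ?G \<sigma> \<tau> p)"
    unfolding set_lebesgue_integral_def
  proof (rule integral_cong_AE)
    show "AE p in lebesgue. indicat_real ({x - pi..<x + pi} \<times> {y - pi..<y + pi}) p *\<^sub>R H p =
        (\<Sum>\<sigma>\<in>{1,-1}. \<Sum>\<tau>\<in>{1,-1}. ?G \<sigma> \<tau> p)"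
      using AE_fst_neq[of x] AE_fst_neq[of "x + pi"] AE_fst_neq[of "x - pi"]
        AE_snd_neq[of y] AE_snd_neq[of "y + pi"] AE_snd_neq[of "y - pi"]
    proof eventually_elim
      case (elim p)
      have ind: "indicat_real {0..pi} (z - w) + indicat_real {0..pi} (w - z) = indicat_real {w - pi..<w + pi} z"
        if "z \<noteq> w" "z \<noteq> w + pi" "z \<noteq> w - pi" for z w
        using that by (auto simp: indicator_def)
      have "(\<Sum>\<sigma>\<in>{1,-1}. \<Sum>\<tau>\<in>{1,-1}. ?G \<sigma> \<tau> p) =
          (indicat_real {0..pi} (fst p - x) + indicat_real {0..pi} (x - fst p)) *
          (indicat_real {0..pi} (snd p - y) + indicat_real {0..pi} (y - snd p)) * H p"
        by (simp add: reflect_shift_def indicator_times algebra_simps)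
      also have "\<dots> = indicat_real ({x - pi..<x + pi} \<times> {y - pi..<y + pi}) p *\<^sub>R H p"
        using elim by (simp add: ind indicator_times)
      finally show ?case by simp
    qed
  next
    show "(\<lambda>p. \<Sum>\<sigma>\<in>{1,-1}. \<Sum>\<tau>\<in>{1,-1}. ?G \<sigma> \<tau> p) \<in> borel_measurable lebesgue"
      by (intro borel_measurable_sum G_meas)
  qed measurable
  also have "\<dots> = (\<Sum>\<sigma>\<in>{1,-1}. integral\<^sup>L lebesgue (\<lambda>p. \<Sum>\<tau>\<in>{1,-1}. ?G \<sigma> \<tau> p))"
    by (rule Bochner_Integration.integral_sum) (intro Bochner_Integration.integrable_sum G_int)
  also have "\<dots> = (\<Sum>\<sigma>\<in>{1,-1}. \<Sum>\<tau>\<in>{1,-1}. integral\<^sup>L lebesgue (?G \<sigma> \<tau>))"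
    by (intro sum.cong refl Bochner_Integration.integral_sum G_int)
  also have "\<dots> = (\<Sum>\<sigma>\<in>{1,-1}. \<Sum>\<tau>\<in>{1,-1}.
       set_lebesgue_integral lebesgue ?Q (\<lambda>p. H (reflect_shift \<sigma> \<tau> x y p)))"
  proof (intro sum.cong refl)
    fix \<sigma> \<tau> :: real assume *: "\<sigma> \<in> {1,-1}" "\<tau> \<in> {1,-1}"
    then have "integral\<^sup>L lebesgue (\<lambda>p. ?G \<sigma> \<tau> (reflect_shift \<sigma> \<tau> x y p)) = integral\<^sup>L lebesgue (?G \<sigma> \<tau>)"
      by (intro integral_reflect_shift G_meas) auto
    then show "integral\<^sup>L lebesgue (?G \<sigma> \<tau>) =
        set_lebesgue_integral lebesgue ?Q (\<lambda>p. H (reflect_shift \<sigma> \<tau> x y p))"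
      using inv[OF *] by (simp add: set_lebesgue_integral_def)
  qed
  finally show ?thesis .
qed

lemma sum_indicator_translates:
  fixes h u :: real
  assumes "0 < h" "0 \<le> u" "u < real (Suc M) * h"
  shows "(\<Sum>i\<le>M. indicat_real {0..<h} (u - real i * h)) = 1"
proof -
  define k where "k = nat \<lfloor>u / h\<rfloor>"
  have k: "real k \<le> u / h" "u / h < real k + 1"
    using assms unfolding k_def by (simp_all add: of_nat_nat)
  then have k': "real k * h \<le> u" "u < (real k + 1) * h"
    using assms by (simp_all add: pos_le_divide_eq pos_divide_less_eq)
  have "real k * h < real (Suc M) * h" using k' assms by linarith
  then have "k \<le> M" using assms by simp
  have ind: "indicat_real {0..<h} (u - real i * h) = (if i = k then 1 else 0)" for i
  proof (cases "i = k")
    case True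
    then show ?thesis using k' by (simp add: indicator_def algebra_simps)
  next
    case False
    then consider "real i + 1 \<le> real k" | "real k + 1 \<le> real i" by linarith
    then have "u - real i * h \<notin> {0..<h}"
    proof cases
      case 1
      then have "(real i + 1) * h \<le> real k * h" using assms by (intro mult_right_mono) auto
      then show ?thesis using k' by (simp add: algebra_simps)
    next
      case 2
      then have "(real k + 1) * h \<le> real i * h" using assms by (intro mult_right_mono) auto
      then show ?thesis using k' by simp
    qed
    then show ?thesis using False by simp
  qed
  show ?thesis using \<open>k \<le> M\<close> by (simp add: ind)
qed

text \<open>Half-open cells tile a region containing the support of \<open>F\<close>, and
  translating a cell to the first one preserves its integral. The finite sums then move inside a
  planar integral, so no section of \<open>F\<close> is ever integrated.\<close>

lemma integral_fold_box:
  fixes F :: "real \<times> real \<Rightarrow> real"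
  assumes F [measurable]: "F \<in> borel_measurable lebesgue" and B: "\<And>p. \<bar>F p\<bar> \<le> B"
    and h: "0 < h" and h': "0 < h'"
    and supp: "\<And>p. F p \<noteq> 0 \<Longrightarrow> 0 \<le> fst p \<and> fst p < real (Suc M) * h \<and> 0 \<le> snd p \<and> snd p < real (Suc N) * h'"
  shows "integral\<^sup>L lebesgue F =
    set_lebesgue_integral lebesgue ({0..<h} \<times> {0..<h'})
      (\<lambda>p. \<Sum>i\<le>M. \<Sum>j\<le>N. F (fst p + real i * h, snd p + real j * h'))"
proof -
  let ?Q = "{0..<h} \<times> {0..<h'}"
  let ?r = "\<lambda>i j. reflect_shift 1 1 (- (real i * h)) (- (real j * h'))"
  let ?s = "\<lambda>i j. reflect_shift 1 1 (real i * h) (real j * h')"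
  let ?G = "\<lambda>i j p. indicat_real ?Q (?r i j p) * F p"
  have Q [measurable]: "?Q \<in> sets lebesgue"
    by (auto simp: borel_Times)
  have [measurable]: "?r i j \<in> lebesgue \<rightarrow>\<^sub>M lebesgue" "?s i j \<in> lebesgue \<rightarrow>\<^sub>M lebesgue" for i j
    by (rule measurable_reflect_shift; simp)+
  have G_meas: "?G i j \<in> borel_measurable lebesgue" for i j
    by measurable
  have int: "integrable lebesgue (\<lambda>p. indicat_real ?Q p * F (?s i j p))" for i j
  proof -
    have "set_integrable lebesgue ?Q (\<lambda>p. F (?s i j p))"
      by (rule bounded_set_integrable[where B = B]) (auto simp: B borel_Times intro!: bounded_Times)
    then show ?thesis by (simp add: set_integrable_def)
  qed
  have eq: "?G i j (?s i j p) = indicat_real ?Q p * F (?s i j p)" for i j p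
    by (simp add: reflect_shift_def)
  have G_int: "integrable lebesgue (?G i j)" for i j
    using integrable_distr_eq[of "?s i j" lebesgue lebesgue "?G i j"] int[of i j] G_meas[of i j]
    by (simp add: distr_reflect_shift eq)
  have "integral\<^sup>L lebesgue F = integral\<^sup>L lebesgue (\<lambda>p. \<Sum>i\<le>M. \<Sum>j\<le>N. ?G i j p)"
  proof (rule Bochner_Integration.integral_cong[OF refl])
    fix p
    have "(\<Sum>i\<le>M. \<Sum>j\<le>N. ?G i j p) =
        (\<Sum>i\<le>M. indicat_real {0..<h} (fst p - real i * h)) * (\<Sum>j\<le>N. indicat_real {0..<h'} (snd p - real j * h')) * F p"
      unfolding sum_product unfolding sum_distrib_right
      by (intro sum.cong refl) (simp add: reflect_shift_def indicator_times)
    also have "\<dots> = F p"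
      using supp[of p] by (cases "F p = 0") (simp_all add: sum_indicator_translates h h')
    finally show "F p = (\<Sum>i\<le>M. \<Sum>j\<le>N. ?G i j p)" by simp
  qed
  also have "\<dots> = (\<Sum>i\<le>M. integral\<^sup>L lebesgue (\<lambda>p. \<Sum>j\<le>N. ?G i j p))"
    by (rule Bochner_Integration.integral_sum) (intro Bochner_Integration.integrable_sum G_int)
  also have "\<dots> = (\<Sum>i\<le>M. \<Sum>j\<le>N. integral\<^sup>L lebesgue (?G i j))"
    by (intro sum.cong refl Bochner_Integration.integral_sum G_int)
  also have "\<dots> = (\<Sum>i\<le>M. \<Sum>j\<le>N. integral\<^sup>L lebesgue (\<lambda>p. indicat_real ?Q p * F (?s i j p)))"
    using integral_reflect_shift[of 1 1 "?G _ _", OF _ _ G_meas] unfolding eq[symmetric] by simp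
  also have "\<dots> = (\<Sum>i\<le>M. integral\<^sup>L lebesgue (\<lambda>p. \<Sum>j\<le>N. indicat_real ?Q p * F (?s i j p)))"
    by (intro sum.cong refl Bochner_Integration.integral_sum[symmetric] int)
  also have "\<dots> = integral\<^sup>L lebesgue (\<lambda>p. \<Sum>i\<le>M. \<Sum>j\<le>N. indicat_real ?Q p * F (?s i j p))"
    by (rule Bochner_Integration.integral_sum[symmetric]) (intro Bochner_Integration.integrable_sum int)
  finally show ?thesis
    by (simp add: set_lebesgue_integral_def sum_distrib_left reflect_shift_def add.commute)
qed

text \<open>A pointwise bound on the open cell suffices because the edges are null.\<close>

lemma integral_box_le:
  fixes W :: "real \<times> real \<Rightarrow> real"
  assumes h: "0 < h" "0 < h'" and e: "e \<ge> 0"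
    and W: "\<And>s t. 0 < s \<Longrightarrow> s < h \<Longrightarrow> 0 < t \<Longrightarrow> t < h' \<Longrightarrow> \<bar>W (s, t)\<bar> \<le> e / (h * h')"
  shows "\<bar>set_lebesgue_integral lebesgue ({0..<h} \<times> {0..<h'}) W\<bar> \<le> e"
proof (cases "set_integrable lebesgue ({0..<h} \<times> {0..<h'}) W")
  case True
  let ?Q = "{0..<h} \<times> {0..<h'}"
  let ?C = "cbox (0, 0) (h, h')"
  have "norm (set_lebesgue_integral lebesgue ?Q W) \<le> integral\<^sup>L lebesgue (\<lambda>p. norm (indicat_real ?Q p *\<^sub>R W p))"
    unfolding set_lebesgue_integral_def by (rule integral_norm_bound)
  also have "\<dots> \<le> integral\<^sup>L lebesgue (\<lambda>p. indicat_real ?C p * (e / (h * h')))"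
  proof (rule integral_mono_AE)
    show "integrable lebesgue (\<lambda>p. norm (indicat_real ?Q p *\<^sub>R W p))"
      using True unfolding set_integrable_def by (rule integrable_norm)
    show "integrable lebesgue (\<lambda>p. indicat_real ?C p * (e / (h * h')))"
      by (intro integrable_mult_left integrable_real_indicator) (auto simp: emeasure_lborel_cbox_eq)
    show "AE p in lebesgue. norm (indicat_real ?Q p *\<^sub>R W p) \<le> indicat_real ?C p * (e / (h * h'))"
      using AE_fst_neq[of 0] AE_snd_neq[of 0]
    proof eventually_elim
      case (elim p)
      show ?case
      proof (cases "p \<in> ?Q")
        case True
        then have "\<bar>W p\<bar> \<le> e / (h * h')"
          using W[of "fst p" "snd p"] elim by (cases p) auto
        then show ?thesis using True by (auto simp: cbox_Pair_eq)
      qed (use e h in simp)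
    qed
  qed
  also have "\<dots> = measure lebesgue ?C * (e / (h * h'))"
    by (simp add: emeasure_lborel_cbox_eq)
  also have "measure lebesgue ?C = h * h'"
    using h by (simp add: content_Pair)
  finally show ?thesis using h by simp
next
  case False
  \<comment> \<open>The integral of a non-integrable function is 0 by convention, so the bound holds
    with no integrability assumption on \<open>W\<close>.\<close>
  then show ?thesis
    using e by (simp add: set_integrable_def set_lebesgue_integral_def not_integrable_integral_eq)
qed

section \<open>The Dirichlet kernel on a grid\<close>

text \<open>Half the sum of the exponentials with frequencies from \<open>-M\<close> to
  \<open>M\<close>; with this normalisation the integral over \<open>{0..pi}\<close> is
  \<open>pi / 2\<close>.\<close>

definition dirichlet_kernel :: "nat \<Rightarrow> real \<Rightarrow> real" where
  "dirichlet_kernel M s = 1 / 2 + (\<Sum>k=1..M. cos (real k * s))"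

text \<open>The product-to-sum formula makes the sum telescope. In multiplied form the identity also
  holds where \<open>sin (s / 2)\<close> vanishes.\<close>

lemma dirichlet_kernel_sin:
  "2 * sin (s / 2) * dirichlet_kernel M s = sin ((real M + 1 / 2) * s)"
proof (induction M)
  case (Suc M)
  have "2 * sin (s / 2) * cos (real (Suc M) * s) =
      sin (real (Suc M) * s + s / 2) - sin (real (Suc M) * s - s / 2)"
    by (simp add: sin_add sin_diff)
  also have "real (Suc M) * s - s / 2 = (real M + 1 / 2) * s"
    by (simp add: field_simps)
  also have "real (Suc M) * s + s / 2 = (real (Suc M) + 1 / 2) * s"
    by (simp add: field_simps)
  finally show ?case
    using Suc by (simp add: dirichlet_kernel_def algebra_simps)
qed (simp add: dirichlet_kernel_def)

lemma dirichlet_kernel_bound: "\<bar>dirichlet_kernel M s\<bar> \<le> real M + 1 / 2"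
proof -
  have "\<bar>\<Sum>k=1..M. cos (real k * s)\<bar> \<le> (\<Sum>k=1..M. 1)"
    by (intro order.trans[OF sum_abs] sum_mono) simp
  then show ?thesis by (simp add: dirichlet_kernel_def)
qed

lemma dirichlet_kernel_minus [simp]: "dirichlet_kernel M (- s) = dirichlet_kernel M s"
  by (simp add: dirichlet_kernel_def)

lemma dirichlet_kernel_periodic:
  "dirichlet_kernel M (s + 2 * pi * of_int k) = dirichlet_kernel M s"
proof -
  have "cos (real n * (s + 2 * pi * of_int k)) = cos (real n * s)" for n
  proof -
    have eq: "real n * (s + 2 * pi * of_int k) = real n * s + 2 * pi * of_int (int n * k)"
      by (simp add: algebra_simps)
    then show ?thesis using cos_int_2pin[of "int n * k"] sin_int_2pin[of "int n * k"]
      unfolding eq cos_add by simp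
  qed
  then show ?thesis by (simp add: dirichlet_kernel_def)
qed

lemma continuous_on_dirichlet_kernel [continuous_intros]:
  fixes g :: "'a::t2_space \<Rightarrow> real"
  shows "continuous_on A g \<Longrightarrow> continuous_on A (\<lambda>x. dirichlet_kernel M (g x))"
  unfolding dirichlet_kernel_def by (intro continuous_intros) auto

lemma integral_dirichlet_kernel: "integral {0..pi} (dirichlet_kernel M) = pi / 2"
proof -
  have "((\<lambda>s. 1 / 2 + (\<Sum>k=1..M. cos (real k * s))) has_integral
      (pi / 2 + (\<Sum>k=1..M. sin (real k * pi) / real k) - (0 / 2 + (\<Sum>k=1..M. sin (real k * 0) / real k)))) {0..pi}"
  proof (rule fundamental_theorem_of_calculus)
    fix x assume "x \<in> {0..pi}"
    have "((\<lambda>s. sin (real k * s) / real k) has_real_derivative cos (real k * x)) (at x within {0..pi})"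
      if "k \<in> {1..M}" for k
      using that by (auto intro!: derivative_eq_intros)
    then have "((\<lambda>s. s / 2 + (\<Sum>k=1..M. sin (real k * s) / real k)) has_real_derivative
        (1 / 2 + (\<Sum>k=1..M. cos (real k * x)))) (at x within {0..pi})"
      by (intro DERIV_add DERIV_sum) (auto intro!: derivative_eq_intros)
    then show "((\<lambda>s. s / 2 + (\<Sum>k=1..M. sin (real k * s) / real k)) has_vector_derivative
        (1 / 2 + (\<Sum>k=1..M. cos (real k * x)))) (at x within {0..pi})"
      by (simp add: has_real_derivative_iff_has_vector_derivative)
  qed simp
  then show ?thesis
    unfolding dirichlet_kernel_def[abs_def] by (intro integral_unique) simp
qed

text \<open>Jordan's inequality: the sine is concave on this interval and so lies above its
  chord.\<close>

lemma sin_ge_chord: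
  assumes "0 \<le> x" "x \<le> pi / 2"
  shows "2 * x / pi \<le> sin x"
proof -
  have "convex_on {0..pi/2} (\<lambda>x. - sin x)"
  proof (rule f''_ge0_imp_convex)
    show "((\<lambda>x. - sin x) has_real_derivative - cos x) (at x)" for x :: real
      by (auto intro!: derivative_eq_intros)
    show "((\<lambda>x. - cos x) has_real_derivative sin x) (at x)" for x :: real
      by (auto intro!: derivative_eq_intros)
    show "sin x \<ge> 0" if "x \<in> {0..pi/2}" for x :: real
      using that by (intro sin_ge_zero) auto
  qed auto
  then have "- sin ((1 - 2 * x / pi) *\<^sub>R 0 + (2 * x / pi) *\<^sub>R (pi / 2))
    \<le> (1 - 2 * x / pi) * (- sin 0) + (2 * x / pi) * (- sin (pi / 2))"
    using assms by (intro convex_onD[of "{0..pi/2}"]) (auto simp: field_simps)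
  then show ?thesis by simp
qed

text \<open>On the grid \<open>s + i h\<close> with \<open>h = \<pi> / (M + 1/2)\<close> the numerator of the Dirichlet kernel alternates in
  sign; these are the absolute values of the kernel there, scaled by \<open>h\<close> and cut off at \<open>\<pi>\<close>.\<close>
definition kernel_weight :: "nat \<Rightarrow> real \<Rightarrow> nat \<Rightarrow> real" where
  "kernel_weight M s i =
     (let h = pi / (real M + 1 / 2) in
      if s + real i * h \<le> pi then h * sin ((real M + 1 / 2) * s) / (2 * sin ((s + real i * h) / 2)) else 0)"

section \<open>Sign, monotonicity and decay of the kernel along a grid\<close>

context
  fixes M :: nat and h s :: real
  assumes h_def: "h = pi / (real M + 1 / 2)" and s: "0 < s" "s < h"
begin

lemma grid_step_pos: "h > 0"
  unfolding h_def by (intro divide_pos_pos) auto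

lemma kernel_numerator_pos: "0 < sin ((real M + 1 / 2) * s)"
proof (rule sin_gt_zero)
  show "0 < (real M + 1 / 2) * s" using s by (intro mult_pos_pos) auto
  have "(real M + 1 / 2) * s < (real M + 1 / 2) * h"
    using s by (intro mult_strict_left_mono) auto
  also have "\<dots> = pi" unfolding h_def by (simp add: field_simps)
  finally show "(real M + 1 / 2) * s < pi" .
qed

lemma half_grid_point_sin_pos:
  assumes "s + real i * h \<le> pi"
  shows "0 < sin ((s + real i * h) / 2)"
proof (rule sin_gt_zero)
  show "0 < (s + real i * h) / 2"
    using s grid_step_pos by (auto intro: add_pos_nonneg)
  show "(s + real i * h) / 2 < pi"
    using le_less_trans[OF assms, of "2 * pi"] by simp
qed

lemma kernel_weight_eq:
  assumes "s + real i * h \<le> pi"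
  shows "kernel_weight M s i = h * sin ((real M + 1 / 2) * s) / (2 * sin ((s + real i * h) / 2))"
  using assms unfolding kernel_weight_def Let_def h_def[symmetric] by (rule if_P)

lemma kernel_weight_eq_0:
  assumes "\<not> s + real i * h \<le> pi"
  shows "kernel_weight M s i = 0"
  using assms unfolding kernel_weight_def Let_def h_def[symmetric] by (rule if_not_P)

text \<open>One grid step advances the argument of the sine on the right of
  \<open>dirichlet_kernel_sin\<close> by exactly pi, which flips its sign and keeps its
  modulus.\<close>

lemma dirichlet_kernel_grid:
  assumes "s + real i * h \<le> pi"
  shows "dirichlet_kernel M (s + real i * h) = (-1) ^ i * kernel_weight M s i / h"
proof -
  have "(real M + 1 / 2) * (s + real i * h) = (real M + 1 / 2) * s + real i * pi"
    unfolding h_def by (simp add: field_simps)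
  then have "sin ((real M + 1 / 2) * (s + real i * h)) = (-1) ^ i * sin ((real M + 1 / 2) * s)"
    by (simp only: sin_add cos_npi sin_npi) simp
  then have "2 * sin ((s + real i * h) / 2) * dirichlet_kernel M (s + real i * h)
      = (-1) ^ i * sin ((real M + 1 / 2) * s)"
    by (simp only: dirichlet_kernel_sin)
  then have "dirichlet_kernel M (s + real i * h)
      = (-1) ^ i * sin ((real M + 1 / 2) * s) / (2 * sin ((s + real i * h) / 2))"
    using half_grid_point_sin_pos[OF assms] by (simp add: eq_divide_eq mult_ac)
  then show ?thesis
    using grid_step_pos by (simp add: kernel_weight_eq[OF assms])
qed

lemma kernel_weight_nonneg: "0 \<le> kernel_weight M s i"
proof (cases "s + real i * h \<le> pi")
  case True
  have "0 \<le> h * sin ((real M + 1 / 2) * s)" "0 < 2 * sin ((s + real i * h) / 2)"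
    using half_grid_point_sin_pos[OF True] kernel_numerator_pos grid_step_pos by simp_all
  then show ?thesis
    unfolding kernel_weight_eq[OF True] by (rule divide_nonneg_pos)
qed (simp add: kernel_weight_eq_0)

text \<open>The numerator does not depend on \<open>i\<close>, and half grid points up to the
  cut-off stay where the sine increases. Past the cut-off the weight drops to 0.\<close>

lemma kernel_weight_Suc_le: "kernel_weight M s (Suc i) \<le> kernel_weight M s i"
proof (cases "s + real (Suc i) * h \<le> pi")
  case True
  then have le: "s + real i * h \<le> pi"
    using grid_step_pos by (simp add: algebra_simps)
  have "sin ((s + real i * h) / 2) \<le> sin ((s + real (Suc i) * h) / 2)"
  proof (rule sin_monotone_2pi_le)
    show "(s + real (Suc i) * h) / 2 \<le> pi / 2" using True by simp
    have "- (pi / 2) \<le> 0" by simp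
    also have "0 \<le> (s + real i * h) / 2"
      using s grid_step_pos by simp
    finally show "- (pi / 2) \<le> (s + real i * h) / 2" .
  qed (use grid_step_pos in \<open>simp add: algebra_simps\<close>)
  then have "h * sin ((real M + 1 / 2) * s) / (2 * sin ((s + real (Suc i) * h) / 2))
      \<le> h * sin ((real M + 1 / 2) * s) / (2 * sin ((s + real i * h) / 2))"
    using half_grid_point_sin_pos[OF True] half_grid_point_sin_pos[OF le] kernel_numerator_pos grid_step_pos
    by (intro divide_left_mono mult_nonneg_nonneg mult_left_mono mult_pos_pos) simp_all
  then show ?thesis unfolding kernel_weight_eq[OF True] kernel_weight_eq[OF le] .
next
  case False
  show ?thesis
    unfolding kernel_weight_eq_0[OF False] by (rule kernel_weight_nonneg)
qed

text \<open>The chord bound makes the denominator linear in the grid point. For \<open>i = 0\<close>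
  that point may be arbitrarily close to 0, which \<open>sin x \<le> x\<close> in the numerator
  compensates; for \<open>i > 0\<close> the denominator is at least of order \<open>i * h\<close>,
  and bounding the sine in the numerator by 1 is enough.\<close>

lemma kernel_weight_le: "kernel_weight M s i \<le> (pi\<^sup>2 / 2) / real (Suc i)"
proof (cases "s + real i * h \<le> pi")
  case True
  let ?u = "s + real i * h" and ?n = "sin ((real M + 1 / 2) * s)"
  have u: "?u > 0" using s grid_step_pos by (auto intro: add_pos_nonneg)
  have "2 * (?u / 2) / pi \<le> sin (?u / 2)"
    using u True by (intro sin_ge_chord) auto
  moreover have "2 * (z / 2) = z" for z :: real
    by simp
  ultimately have chord: "2 * (?u / pi) \<le> 2 * sin (?u / 2)"
    by (simp only: mult_le_cancel_left_pos zero_less_numeral)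
  have n: "0 \<le> h * ?n"
    using kernel_numerator_pos grid_step_pos by simp
  have pos: "0 < 2 * (?u / pi)"
    using u by simp
  have "kernel_weight M s i \<le> h * ?n / (2 * (?u / pi))"
    unfolding kernel_weight_eq[OF True]
    by (rule divide_left_mono[OF chord n mult_pos_pos[OF less_le_trans[OF pos chord] pos]])
  also have "\<dots> \<le> (pi\<^sup>2 / 2) / real (Suc i)"
  proof (cases "i = 0")
    case True
    have "?n \<le> (real M + 1 / 2) * s"
      using s by (intro sin_x_le_x) auto
    also have "\<dots> = pi * s / h" unfolding h_def by (simp add: field_simps)
    finally have "h * ?n \<le> pi * s"
      using grid_step_pos by (simp add: pos_le_divide_eq mult.commute)
    then have "h * ?n / (2 * (?u / pi)) \<le> pi * s / (2 * (?u / pi))"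
      using pos by (rule divide_right_mono[OF _ less_imp_le])
    also have "\<dots> = pi\<^sup>2 / 2" using True s by (simp add: power2_eq_square)
    finally show ?thesis using True by simp
  next
    case False
    have "h * ?n / (2 * (?u / pi)) \<le> h * 1 / (2 * (?u / pi))"
      using pos grid_step_pos by (intro divide_right_mono mult_left_mono) (simp_all only: less_imp_le sin_le_one)
    also have "\<dots> \<le> h * 1 / (2 * (real i * h / pi))"
    proof (rule divide_left_mono)
      have "0 < real i * h / pi" using grid_step_pos False by simp
      then show "0 < 2 * (?u / pi) * (2 * (real i * h / pi))" by (intro mult_pos_pos[OF pos]) simp
      have "real i * h / pi \<le> ?u / pi" using s by (intro divide_right_mono) auto
      then show "2 * (real i * h / pi) \<le> 2 * (?u / pi)" by (rule mult_left_mono) simp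
    qed (use grid_step_pos in simp)
    also have "\<dots> = pi / (2 * real i)" using grid_step_pos False by simp
    \<comment> \<open>Since \<open>i\<close> is positive, \<open>Suc i \<le> 2 * i\<close>. The
      constant is then enlarged to the one arising for \<open>i = 0\<close>.\<close>
    also have "\<dots> \<le> (pi * 2 / 2) / real (Suc i)"
      using False by (simp add: divide_simps)
    also have "\<dots> \<le> (pi * pi / 2) / real (Suc i)"
      using pi_ge_two by (intro divide_right_mono mult_left_mono) auto
    finally show ?thesis by (simp add: power2_eq_square)
  qed
  finally show ?thesis .
next
  case False
  then show ?thesis by (simp add: kernel_weight_eq_0)
qed

end

section \<open>Quadrant integrals\<close>

text \<open>After the double summation by parts, alternation supplies the decay that
  \<open>double_sum_bdiff_le\<close> asks for: a tail is bounded by its first weight.\<close>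

lemma alternating_weighted_double_sum_le:
  fixes c :: "nat \<Rightarrow> nat \<Rightarrow> real" and \<Lambda> a b :: "nat \<Rightarrow> real"
  assumes pos: "\<And>j. j \<ge> 1 \<Longrightarrow> \<Lambda> j > 0"
    and mono: "\<And>i j. 1 \<le> i \<Longrightarrow> i \<le> j \<Longrightarrow> \<Lambda> j / real j \<le> \<Lambda> i / real i"
    and m: "m \<ge> 1"
    and S: "\<And>n. (\<Sum>j\<le>n. \<Lambda> (max j m) / real (max j m) / real (Suc j)) \<le> S"
    and V0: "V \<ge> 0" and \<eta>: "\<eta> \<ge> 0"
    and V1: "\<And>j. j \<le> N \<Longrightarrow> (\<Sum>i=1..M. \<bar>c i j - c (i - 1) j\<bar> / \<Lambda> i) \<le> V"
    and V2: "\<And>i. i \<le> M \<Longrightarrow> (\<Sum>j=1..N. \<bar>c i j - c i (j - 1)\<bar> / \<Lambda> j) \<le> V"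
    and corner: "\<And>i j. i \<le> m \<Longrightarrow> j \<le> m \<Longrightarrow> i \<le> M \<Longrightarrow> j \<le> N \<Longrightarrow> \<bar>c i j\<bar> \<le> \<eta>"
    and a: "\<And>i. 0 \<le> a i" "\<And>i. a (Suc i) \<le> a i" "\<And>i. a i \<le> C / real (Suc i)"
    and b: "\<And>j. 0 \<le> b j" "\<And>j. b (Suc j) \<le> b j" "\<And>j. b j \<le> C / real (Suc j)"
  shows "\<bar>\<Sum>i\<le>M. \<Sum>j\<le>N. c i j * ((-1) ^ i * a i) * ((-1) ^ j * b j)\<bar>
    \<le> C\<^sup>2 * (4 * \<eta> * (real (Suc m))\<^sup>2 + 4 * S * V)"
  unfolding double_summation_by_parts[of c "\<lambda>i. (-1) ^ i * a i"]
proof (rule double_sum_bdiff_le[OF pos mono m S V0 \<eta> V1 V2 corner])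
  show "\<bar>\<Sum>l=i..M. (-1) ^ l * a l\<bar> \<le> C / real (Suc i)" for i
    using alternating_tail_bound[of a i M] a by (meson order.trans)
  show "\<bar>\<Sum>l=j..N. (-1) ^ l * b l\<bar> \<le> C / real (Suc j)" for j
    using alternating_tail_bound[of b j N] b by (meson order.trans)
qed

abbreviation "quadrant \<equiv> {0..pi} \<times> {0..pi} :: (real \<times> real) set"

definition quadrant_integral :: "nat \<Rightarrow> nat \<Rightarrow> (real \<times> real \<Rightarrow> real) \<Rightarrow> real" where
  "quadrant_integral M N \<phi> = set_lebesgue_integral lebesgue quadrant
     (\<lambda>p. \<phi> p * (dirichlet_kernel M (fst p) * dirichlet_kernel N (snd p)))"

lemma dirichlet_kernel_product_bound:
  "\<bar>dirichlet_kernel M s * dirichlet_kernel N t\<bar> \<le> (real M + 1 / 2) * (real N + 1 / 2)"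
  unfolding abs_mult by (intro mult_mono dirichlet_kernel_bound) auto

lemma dirichlet_kernel_product_measurable [measurable]:
  "(\<lambda>p. dirichlet_kernel M (fst p - x) * dirichlet_kernel N (snd p - y)) \<in> borel_measurable lebesgue"
  by (rule measurable_completion) (simp, intro borel_measurable_continuous_onI continuous_intros)

lemma dirichlet_kernel_product_measurable0 [measurable]:
  "(\<lambda>p. dirichlet_kernel M (fst p) * dirichlet_kernel N (snd p)) \<in> borel_measurable lebesgue"
  using dirichlet_kernel_product_measurable[of M 0 N 0] by simp

lemma quadrant_integrable:
  assumes [measurable]: "\<phi> \<in> borel_measurable lebesgue" and B: "\<And>p. \<bar>\<phi> p\<bar> \<le> B"
  shows "set_integrable lebesgue quadrant
     (\<lambda>p. \<phi> p * (dirichlet_kernel M (fst p) * dirichlet_kernel N (snd p)))"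
proof (rule bounded_set_integrable)
  fix p :: "real \<times> real"
  have "0 \<le> B" using B[of undefined] by linarith
  then show "norm (\<phi> p * (dirichlet_kernel M (fst p) * dirichlet_kernel N (snd p)))
      \<le> B * ((real M + 1 / 2) * (real N + 1 / 2))"
    unfolding real_norm_def abs_mult[of "\<phi> p"]
    by (intro mult_mono B dirichlet_kernel_product_bound) auto
qed (auto simp: borel_Times intro!: bounded_Times)

text \<open>Lets a constant be subtracted from the function. After division by
  \<open>pi\<^sup>2\<close> each quadrant gives its constant the weight 1/4, as in the mean of the
  quadrant limits.\<close>

lemma quadrant_integral_const: "quadrant_integral M N (\<lambda>_. c) = c * pi\<^sup>2 / 4"
proof -
  let ?K = "\<lambda>p. dirichlet_kernel M (fst p) * dirichlet_kernel N (snd p)"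
  have "quadrant_integral M N (\<lambda>_. c) = c * set_lebesgue_integral lebesgue quadrant ?K"
    unfolding quadrant_integral_def by (rule set_integral_mult_right)
  also have "set_lebesgue_integral lebesgue quadrant ?K = integral quadrant ?K"
    using quadrant_integrable[of "\<lambda>_. 1" 1 M N] by (intro set_lebesgue_integral_eq_integral) simp
  also have "\<dots> = integral (cbox (0, 0) (pi, pi)) ?K"
    by (simp add: cbox_Pair_eq)
  also have "\<dots> = integral (cbox 0 pi) (\<lambda>s. integral (cbox 0 pi) (\<lambda>t. ?K (s, t)))"
    by (intro integral_prod_continuous continuous_intros)
  also have "\<dots> = integral {0..pi} (dirichlet_kernel M) * integral {0..pi} (dirichlet_kernel N)"
    by simp
  also have "\<dots> = pi / 2 * (pi / 2)"
    by (simp only: integral_dirichlet_kernel)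
  finally show ?thesis by (simp add: power2_eq_square)
qed

text \<open>By the scaling of \<open>kernel_weight\<close>, the folded integrand is the alternating
  double sum divided by \<open>h * h'\<close>. This factor cancels against the area of the cell, so
  a pointwise bound on the sum passes unchanged to the integral.\<close>

lemma quadrant_integral_fold_le:
  fixes \<phi> :: "real \<times> real \<Rightarrow> real"
  assumes meas [measurable]: "\<phi> \<in> borel_measurable lebesgue" and B: "\<And>p. \<bar>\<phi> p\<bar> \<le> B" and e: "e \<ge> 0"
    and h: "h = pi / (real M + 1 / 2)" and h': "h' = pi / (real N + 1 / 2)"
    and W: "\<And>s t. 0 < s \<Longrightarrow> s < h \<Longrightarrow> 0 < t \<Longrightarrow> t < h' \<Longrightarrow>
      \<bar>\<Sum>i\<le>M. \<Sum>j\<le>N. \<phi> (s + real i * h, t + real j * h') *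
         ((-1) ^ i * kernel_weight M s i) * ((-1) ^ j * kernel_weight N t j)\<bar> \<le> e"
  shows "\<bar>quadrant_integral M N \<phi>\<bar> \<le> e"
proof -
  let ?K = "\<lambda>p. dirichlet_kernel M (fst p) * dirichlet_kernel N (snd p)"
  let ?F = "\<lambda>p. indicat_real quadrant p * (\<phi> p * ?K p)"
  have h0: "h > 0" "h' > 0"
    using grid_step_pos h h' by auto
  have [measurable]: "quadrant \<in> sets lebesgue"
    by (auto simp: borel_Times)
  have B0: "0 \<le> B" using B[of undefined] by linarith
  \<comment> \<open>The \<open>Suc n\<close> cells overshoot pi by half a cell, so they cover the
    closed interval up to pi.\<close>
  have pi_less: "pi < real (Suc n) * (pi / (real n + 1 / 2))" for n
    by (simp add: field_simps)
  have "quadrant_integral M N \<phi> = integral\<^sup>L lebesgue ?F"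
    by (simp add: quadrant_integral_def set_lebesgue_integral_def)
  also have "\<dots> = set_lebesgue_integral lebesgue ({0..<h} \<times> {0..<h'})
      (\<lambda>p. \<Sum>i\<le>M. \<Sum>j\<le>N. ?F (fst p + real i * h, snd p + real j * h'))"
  proof (rule integral_fold_box[OF _ _ h0])
    show "?F \<in> borel_measurable lebesgue" by measurable
    show "\<bar>?F p\<bar> \<le> B * ((real M + 1 / 2) * (real N + 1 / 2))" for p
    proof -
      have "\<bar>\<phi> p * ?K p\<bar> \<le> B * ((real M + 1 / 2) * (real N + 1 / 2))"
        unfolding abs_mult[of "\<phi> p"]
        using B0 by (intro mult_mono B dirichlet_kernel_product_bound) auto
      then show ?thesis using B0 by (auto simp: indicator_def)
    qed
    show "0 \<le> fst p \<and> fst p < real (Suc M) * h \<and> 0 \<le> snd p \<and> snd p < real (Suc N) * h'" if "?F p \<noteq> 0" for p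
    proof -
      have "p \<in> quadrant" using that by (auto simp: indicator_def split: if_splits)
      then show ?thesis
        using pi_less[of M] pi_less[of N] unfolding h h' by (cases p) auto
    qed
  qed
  finally have eq: "quadrant_integral M N \<phi> = set_lebesgue_integral lebesgue ({0..<h} \<times> {0..<h'})
      (\<lambda>p. \<Sum>i\<le>M. \<Sum>j\<le>N. ?F (fst p + real i * h, snd p + real j * h'))" .
  show ?thesis
    unfolding eq
  proof (rule integral_box_le[OF h0 e])
    fix s t assume s: "0 < s" "s < h" and t: "0 < t" "t < h'"
    have F: "?F (s + real i * h, t + real j * h') =
        \<phi> (s + real i * h, t + real j * h') *
         ((-1) ^ i * kernel_weight M s i) * ((-1) ^ j * kernel_weight N t j) / (h * h')" for i j
    proof (cases "s + real i * h \<le> pi \<and> t + real j * h' \<le> pi")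
      case True
      have "(s + real i * h, t + real j * h') \<in> quadrant"
        using True s t h0 by simp
      then show ?thesis
        using dirichlet_kernel_grid[OF h s, of i] dirichlet_kernel_grid[OF h' t, of j] True
        by simp
    next
      \<comment> \<open>The translated point is outside the quadrant, where the indicator vanishes;
        the cut-off in \<open>kernel_weight\<close> matches this.\<close>
      case False
      then have "kernel_weight M s i = 0 \<or> kernel_weight N t j = 0"
        using kernel_weight_eq_0[OF h s, of i] kernel_weight_eq_0[OF h' t, of j] by blast
      then show ?thesis using False by auto
    qed
    have "\<bar>\<Sum>i\<le>M. \<Sum>j\<le>N. ?F (s + real i * h, t + real j * h')\<bar> =
        \<bar>\<Sum>i\<le>M. \<Sum>j\<le>N. \<phi> (s + real i * h, t + real j * h') *
         ((-1) ^ i * kernel_weight M s i) * ((-1) ^ j * kernel_weight N t j)\<bar> / (h * h')"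
      unfolding F sum_divide_distrib[symmetric] using h0 by simp
    also have "\<dots> \<le> e / (h * h')"
      using h0 by (intro divide_right_mono W s t) auto
    finally show "\<bar>\<Sum>i\<le>M. \<Sum>j\<le>N. ?F (fst (s, t) + real i * h, snd (s, t) + real j * h')\<bar> \<le> e / (h * h')"
      by simp
  qed
qed

text \<open>The order of the quantifiers is what yields uniformity: \<open>\<eta>\<close> is chosen
  before \<open>\<delta>\<close>, then \<open>n0\<close>, and neither depends on
  \<open>\<phi>\<close> or on its bound \<open>B\<close>.\<close>

lemma quadrant_integral_small:
  fixes \<Lambda> :: "nat \<Rightarrow> real"
  assumes pos: "\<And>j. j \<ge> 1 \<Longrightarrow> \<Lambda> j > 0"
    and summ: "summable (\<lambda>j. \<Lambda> (Suc j) / real (Suc j) ^ 2)"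
    and mono: "\<And>i j. 1 \<le> i \<Longrightarrow> i \<le> j \<Longrightarrow> \<Lambda> j / real j \<le> \<Lambda> i / real i"
    and lim: "(\<lambda>j. \<Lambda> j / real j) \<longlonglongrightarrow> 0"
    and e: "e > 0" and V0: "V \<ge> 0"
  obtains \<eta> where "\<eta> > 0"
    "\<And>\<delta>. \<delta> > 0 \<Longrightarrow> \<exists>n0. \<forall>M\<ge>n0. \<forall>N\<ge>n0. \<forall>\<phi> B. \<phi> \<in> borel_measurable lebesgue \<longrightarrow>
       (\<forall>p. \<bar>\<phi> p\<bar> \<le> B) \<longrightarrow>
       (\<forall>t. grid_variation_le \<Lambda> V (\<lambda>s. \<phi> (s, t))) \<longrightarrow> (\<forall>s. grid_variation_le \<Lambda> V (\<lambda>t. \<phi> (s, t))) \<longrightarrow>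
       (\<forall>s t. 0 < s \<longrightarrow> s < \<delta> \<longrightarrow> 0 < t \<longrightarrow> t < \<delta> \<longrightarrow> \<bar>\<phi> (s, t)\<bar> \<le> \<eta>) \<longrightarrow>
       \<bar>quadrant_integral M N \<phi>\<bar> \<le> e"
proof -
  define C where "C = pi\<^sup>2 / 2"
  have C: "C > 0" by (simp add: C_def)
  \<comment> \<open>Chosen so that the off-corner part stays below \<open>e / 2\<close>;
    \<open>V + 1\<close> in place of \<open>V\<close> keeps the divisor positive when
    \<open>V = 0\<close>.\<close>
  define S where "S = e / (8 * C\<^sup>2 * (V + 1))"
  have "S > 0" unfolding S_def using e V0 C by (intro divide_pos_pos mult_pos_pos) auto
  then obtain m where m: "m \<ge> 1"
    and S: "\<And>n. (\<Sum>j\<le>n. \<Lambda> (max j m) / real (max j m) / real (Suc j)) \<le> S"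
    using truncated_weight_sum_small[OF pos summ mono lim] by blast
  \<comment> \<open>\<open>m\<close> has to be fixed first: the corner has
    \<open>(Suc m)\<^sup>2\<close> cells, and \<open>\<eta>\<close> makes their total contribution
    \<open>e / 2\<close>.\<close>
  define \<eta> where "\<eta> = e / (8 * C\<^sup>2 * (real (Suc m))\<^sup>2)"
  have \<eta>: "\<eta> > 0" unfolding \<eta>_def using e C by (intro divide_pos_pos mult_pos_pos) auto
  have total: "C\<^sup>2 * (4 * \<eta> * (real (Suc m))\<^sup>2 + 4 * S * V) \<le> e"
  proof -
    have corner_part: "C\<^sup>2 * (4 * \<eta> * (real (Suc m))\<^sup>2) = e / 2"
      using C unfolding \<eta>_def by (simp add: divide_simps)
    have "C\<^sup>2 * (4 * S * V) = e / 2 * (V / (V + 1))"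
      using C V0 unfolding S_def by (simp add: divide_simps)
    also have "\<dots> \<le> e / 2 * 1"
      using e V0 by (intro mult_left_mono) auto
    finally show ?thesis
      unfolding distrib_left corner_part by simp
  qed
  show ?thesis
  proof (rule that[OF \<eta>])
    fix \<delta> :: real assume \<delta>: "\<delta> > 0"
    \<comment> \<open>From here on \<open>Suc m\<close> cells fit into length
      \<open>\<delta>\<close>, so all translated points with both indices at most \<open>m\<close>
      lie where \<open>\<phi>\<close> is small.\<close>
    define n0 where "n0 = nat \<lceil>pi * real (Suc m) / \<delta>\<rceil>"
    have step: "pi / (real n + 1 / 2) * real (Suc m) \<le> \<delta>" if "n \<ge> n0" for n
    proof -
      have "pi * real (Suc m) / \<delta> \<le> real n + 1 / 2"
        using that unfolding n0_def by linarith
      then show ?thesis using \<delta> by (simp add: pos_divide_le_eq mult_ac)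
    qed
    have span: "real n * (pi / (real n + 1 / 2)) \<le> 2 * pi" for n
      by (simp add: field_simps)
    have "\<bar>quadrant_integral M N \<phi>\<bar> \<le> e"
      if MN: "M \<ge> n0" "N \<ge> n0" and \<phi>: "\<phi> \<in> borel_measurable lebesgue" and B: "\<forall>p. \<bar>\<phi> p\<bar> \<le> B"
        and V1: "\<forall>t. grid_variation_le \<Lambda> V (\<lambda>s. \<phi> (s, t))"
        and V2: "\<forall>s. grid_variation_le \<Lambda> V (\<lambda>t. \<phi> (s, t))"
        and small: "\<forall>s t. 0 < s \<longrightarrow> s < \<delta> \<longrightarrow> 0 < t \<longrightarrow> t < \<delta> \<longrightarrow> \<bar>\<phi> (s, t)\<bar> \<le> \<eta>"
      for M N \<phi> B
    proof -
      define h where "h = pi / (real M + 1 / 2)"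
      define h' where "h' = pi / (real N + 1 / 2)"
      have h0: "h > 0" "h' > 0"
        using grid_step_pos h_def h'_def by auto
      show ?thesis
      proof (rule quadrant_integral_fold_le[OF \<phi> _ _ h_def h'_def])
        fix s t assume s: "0 < s" "s < h" and t: "0 < t" "t < h'"
        have near: "z + real i * k < \<delta>" if "i \<le> m" "z < k" "k * real (Suc m) \<le> \<delta>" "0 < k" for i z k
        proof -
          have "real i * k \<le> real m * k" using that by (intro mult_right_mono) auto
          moreover have "k * real (Suc m) = real m * k + k" by (simp add: algebra_simps)
          ultimately show ?thesis using that by linarith
        qed
        have "\<bar>\<Sum>i\<le>M. \<Sum>j\<le>N. \<phi> (s + real i * h, t + real j * h') *
         ((-1) ^ i * kernel_weight M s i) * ((-1) ^ j * kernel_weight N t j)\<bar>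
         \<le> C\<^sup>2 * (4 * \<eta> * (real (Suc m))\<^sup>2 + 4 * S * V)"
        proof (rule alternating_weighted_double_sum_le[OF pos mono m S V0])
          show "(\<Sum>i=1..M. \<bar>\<phi> (s + real i * h, t + real j * h') - \<phi> (s + real (i - 1) * h, t + real j * h')\<bar> / \<Lambda> i) \<le> V" for j
            using V1 h0 span[of M] unfolding grid_variation_le_def h_def[symmetric] by blast
          show "(\<Sum>j=1..N. \<bar>\<phi> (s + real i * h, t + real j * h') - \<phi> (s + real i * h, t + real (j - 1) * h')\<bar> / \<Lambda> j) \<le> V" for i
            using V2 h0 span[of N] unfolding grid_variation_le_def h'_def[symmetric] by blast
          show "\<bar>\<phi> (s + real i * h, t + real j * h')\<bar> \<le> \<eta>" if "i \<le> m" "j \<le> m" for i j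
            using near[OF that(1) s(2) step[OF MN(1), folded h_def] h0(1)]
              near[OF that(2) t(2) step[OF MN(2), folded h'_def] h0(2)]
              add_pos_nonneg[OF s(1), of "real i * h"] add_pos_nonneg[OF t(1), of "real j * h'"] h0 small
            by simp
          show "0 \<le> \<eta>" using \<eta> by simp
        qed (assumption | rule kernel_weight_nonneg[OF h_def s] kernel_weight_Suc_le[OF h_def s]
              kernel_weight_le[OF h_def s, folded C_def] kernel_weight_nonneg[OF h'_def t]
              kernel_weight_Suc_le[OF h'_def t] kernel_weight_le[OF h'_def t, folded C_def])+
        then show "\<bar>\<Sum>i\<le>M. \<Sum>j\<le>N. \<phi> (s + real i * h, t + real j * h') *
         ((-1) ^ i * kernel_weight M s i) * ((-1) ^ j * kernel_weight N t j)\<bar> \<le> e"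
          using total by linarith
      qed (use B e in auto)
    qed
    then show "\<exists>n0. \<forall>M\<ge>n0. \<forall>N\<ge>n0. \<forall>\<phi> B. \<phi> \<in> borel_measurable lebesgue \<longrightarrow>
       (\<forall>p. \<bar>\<phi> p\<bar> \<le> B) \<longrightarrow>
       (\<forall>t. grid_variation_le \<Lambda> V (\<lambda>s. \<phi> (s, t))) \<longrightarrow> (\<forall>s. grid_variation_le \<Lambda> V (\<lambda>t. \<phi> (s, t))) \<longrightarrow>
       (\<forall>s t. 0 < s \<longrightarrow> s < \<delta> \<longrightarrow> 0 < t \<longrightarrow> t < \<delta> \<longrightarrow> \<bar>\<phi> (s, t)\<bar> \<le> \<eta>) \<longrightarrow>
       \<bar>quadrant_integral M N \<phi>\<bar> \<le> e"
      by blast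
  qed
qed

section \<open>Rectangular partial sums\<close>

text \<open>The plane splits into countably many period cells, labelled by two integer parts. On
  each of them \<open>f\<close> is a translate of its measurable restriction to the basic
  square.\<close>

lemma periodic_borel_measurable_lebesgue:
  fixes f :: "real \<times> real \<Rightarrow> real"
  assumes f: "set_borel_measurable lebesgue (torus \<times> torus) f"
    and per1: "\<And>x y. f (x + 2 * pi, y) = f (x, y)"
    and per2: "\<And>x y. f (x, y + 2 * pi) = f (x, y)"
  shows "f \<in> borel_measurable lebesgue"
proof -
  define k where "k x = \<lfloor>x / (2 * pi)\<rfloor>" for x :: real
  define g where "g = (\<lambda>p. indicat_real (torus \<times> torus) p *\<^sub>R f p)"
  have g: "g \<in> borel_measurable lebesgue"
    using f unfolding g_def set_borel_measurable_def .
  let ?T = "\<lambda>kl p. reflect_shift 1 1 (- (2 * pi * of_int (fst kl))) (- (2 * pi * of_int (snd kl))) p"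
  have "f = (\<lambda>p. g (?T (k (fst p), k (snd p)) p))"
  proof
    fix p :: "real \<times> real"
    have k: "x - 2 * pi * of_int (k x) \<in> torus" for x
    proof -
      have "of_int (k x) \<le> x / (2 * pi)" "x / (2 * pi) < of_int (k x) + 1"
        unfolding k_def by linarith+
      then show ?thesis by (auto simp: pos_le_divide_eq pos_divide_less_eq algebra_simps)
    qed
    obtain x y where p: "p = (x, y)" by (cases p)
    have "f (x, y) = f (x - 2 * pi * of_int (k x), y - 2 * pi * of_int (k y))"
      using periodic_shift_int[of "\<lambda>x. f (x, y)", OF per1, of "x - 2 * pi * of_int (k x)" "k x"]
        periodic_shift_int[of "\<lambda>z. f (x - 2 * pi * of_int (k x), z)", OF per2, of "y - 2 * pi * of_int (k y)" "k y"]
      by simp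
    moreover have "?T (k x, k y) (x, y) = (x - 2 * pi * of_int (k x), y - 2 * pi * of_int (k y))"
      by (simp add: reflect_shift_def)
    moreover have "(x - 2 * pi * of_int (k x), y - 2 * pi * of_int (k y)) \<in> torus \<times> torus"
      using k[of x] k[of y] by blast
    ultimately show "f p = g (?T (k (fst p), k (snd p)) p)"
      by (simp add: p g_def)
  qed
  moreover have "(\<lambda>p. g (?T (k (fst p), k (snd p)) p)) \<in> borel_measurable lebesgue"
  proof (rule measurable_compose_countable[of "\<lambda>kl p. g (?T kl p)"])
    show "(\<lambda>p. g (?T kl p)) \<in> borel_measurable lebesgue" for kl
      by (rule measurable_compose[OF measurable_reflect_shift g]) auto
    have [measurable]: "(fst :: real \<times> real \<Rightarrow> real) \<in> borel_measurable borel"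
      "(snd :: real \<times> real \<Rightarrow> real) \<in> borel_measurable borel"
      by (intro borel_measurable_continuous_onI continuous_intros)+
    have [measurable]: "k \<in> measurable borel (count_space UNIV)"
      unfolding k_def by measurable
    have "(\<lambda>p::real \<times> real. (k (fst p), k (snd p))) \<in> measurable borel (count_space UNIV \<Otimes>\<^sub>M count_space UNIV)"
      by measurable
    then show "(\<lambda>p::real \<times> real. (k (fst p), k (snd p))) \<in> measurable lebesgue (count_space UNIV)"
      by (intro measurable_completion) (simp add: pair_measure_countable)
  qed
  ultimately show ?thesis by (simp only:)
qed

lemma sum_exp_eq_dirichlet_kernel:
  "(\<Sum>m = - int M..int M. exp (\<i> * of_int m * of_real s)) = of_real (2 * dirichlet_kernel M s)"
proof (induction M)
  case (Suc M)
  have "{- int (Suc M)..int (Suc M)} = insert (- int (Suc M)) (insert (int (Suc M)) {- int M..int M})"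
    by auto
  then have "(\<Sum>m = - int (Suc M)..int (Suc M). exp (\<i> * of_int m * of_real s)) =
      exp (\<i> * of_int (- int (Suc M)) * of_real s) + (exp (\<i> * of_int (int (Suc M)) * of_real s)
       + (\<Sum>m = - int M..int M. exp (\<i> * of_int m * of_real s)))"
    by simp
  also have "exp (\<i> * of_int (- int (Suc M)) * of_real s) + (exp (\<i> * of_int (int (Suc M)) * of_real s) + z)
      = of_real (2 * cos (real (Suc M) * s)) + z" for z
  proof -
    have "\<i> * of_int (int (Suc M)) * of_real s = \<i> * of_real (real (Suc M) * s)"
      "\<i> * of_int (- int (Suc M)) * of_real s = \<i> * of_real (- (real (Suc M) * s))"
      by (simp_all add: algebra_simps)
    then show ?thesis
      by (simp only: cis_conv_exp[symmetric]) (simp add: complex_eq_iff)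
  qed
  also have "of_real (2 * cos (real (Suc M) * s)) + (\<Sum>m = - int M..int M. exp (\<i> * of_int m * of_real s))
      = complex_of_real (2 * dirichlet_kernel (Suc M) s)"
    unfolding Suc.IH by (simp add: dirichlet_kernel_def algebra_simps)
  finally show ?case .
qed (simp add: dirichlet_kernel_def)

text \<open>The finite sums move inside the integral and factor into two sums of exponentials. Each
  is twice a kernel, which cancels the 4 of the normalising constant.\<close>

lemma rect_partial_sum_eq_integral:
  fixes f :: "real \<times> real \<Rightarrow> real"
  assumes f [measurable]: "f \<in> borel_measurable lebesgue" and B: "\<And>p. \<bar>f p\<bar> \<le> B"
  shows "rect_partial_sum f M N (x, y) = of_real (1 / pi\<^sup>2 *
    set_lebesgue_integral lebesgue (torus \<times> torus)
      (\<lambda>p. f p * (dirichlet_kernel M (fst p - x) * dirichlet_kernel N (snd p - y))))"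
proof -
  let ?T = "torus \<times> torus"
  let ?g = "\<lambda>m n p. complex_of_real (f p) * exp (- \<i> * of_int m * of_real (fst p)) * exp (- \<i> * of_int n * of_real (snd p))"
  let ?c = "\<lambda>m n. exp (\<i> * of_int m * of_real x) * exp (\<i> * of_int n * of_real y)"
  let ?K = "\<lambda>p. dirichlet_kernel M (fst p - x) * dirichlet_kernel N (snd p - y)"
  have int: "set_integrable lebesgue ?T (\<lambda>p. ?g m n p * ?c m n)" for m n
  proof (rule bounded_set_integrable)
    have [measurable]: "(\<lambda>p::real\<times>real. exp (- \<i> * of_int m * of_real (fst p)) * exp (- \<i> * of_int n * of_real (snd p)) * ?c m n)
        \<in> borel_measurable lebesgue"
      by (rule measurable_completion) (simp, intro borel_measurable_continuous_onI continuous_intros)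
    have "(\<lambda>p. complex_of_real (f p) * (exp (- \<i> * of_int m * of_real (fst p)) * exp (- \<i> * of_int n * of_real (snd p)) * ?c m n))
        \<in> borel_measurable lebesgue"
      by measurable
    then show "(\<lambda>p. ?g m n p * ?c m n) \<in> borel_measurable lebesgue"
      by (simp only: mult.assoc)
    show "norm (?g m n p * ?c m n) \<le> B" for p
      using B[of p] by (simp add: norm_mult)
  qed (auto simp: borel_Times intro!: bounded_Times)
  have "rect_partial_sum f M N (x, y) =
      1 / (4 * complex_of_real pi ^ 2) *
      (\<Sum>m = - int M..int M. \<Sum>n = - int N..int N. set_lebesgue_integral lebesgue ?T (\<lambda>p. ?g m n p * ?c m n))"
    unfolding rect_partial_sum_def prod.case sum_distrib_left
  proof (intro sum.cong refl)
    fix m n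
    show "fourier_coeff2 f m n * exp (\<i> * of_int m * of_real x) * exp (\<i> * of_int n * of_real y) =
        1 / (4 * complex_of_real pi ^ 2) * set_lebesgue_integral lebesgue ?T (\<lambda>p. ?g m n p * ?c m n)"
      unfolding fourier_coeff2_def case_prod_unfold prod.collapse set_integral_mult_left by (simp only: mult.assoc)
  qed
  also have "(\<Sum>m = - int M..int M. \<Sum>n = - int N..int N. set_lebesgue_integral lebesgue ?T (\<lambda>p. ?g m n p * ?c m n))
     = set_lebesgue_integral lebesgue ?T (\<lambda>p. \<Sum>m = - int M..int M. \<Sum>n = - int N..int N. ?g m n p * ?c m n)"
    using int unfolding set_lebesgue_integral_def set_integrable_def
    by (simp only: scaleR_sum_right Bochner_Integration.integral_sum Bochner_Integration.integrable_sum)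
  also have "(\<lambda>p. \<Sum>m = - int M..int M. \<Sum>n = - int N..int N. ?g m n p * ?c m n) =
      (\<lambda>p. complex_of_real (4 * (f p * ?K p)))"
  proof
    fix p :: "real \<times> real"
    have "?g m n p * ?c m n = of_real (f p) * (exp (\<i> * of_int m * of_real (x - fst p)) * exp (\<i> * of_int n * of_real (y - snd p)))" for m n
      by (simp add: exp_add[symmetric] algebra_simps)
    then have "(\<Sum>m = - int M..int M. \<Sum>n = - int N..int N. ?g m n p * ?c m n) =
        of_real (f p) * ((\<Sum>m = - int M..int M. exp (\<i> * of_int m * of_real (x - fst p))) *
          (\<Sum>n = - int N..int N. exp (\<i> * of_int n * of_real (y - snd p))))"
      unfolding sum_product by (simp only: sum_distrib_left)
    also have "\<dots> = of_real (f p * (2 * dirichlet_kernel M (x - fst p) * (2 * dirichlet_kernel N (y - snd p))))"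
      by (simp only: sum_exp_eq_dirichlet_kernel of_real_mult)
    also have "dirichlet_kernel M (x - fst p) = dirichlet_kernel M (fst p - x)"
      using dirichlet_kernel_minus[of M "fst p - x"] by simp
    also have "dirichlet_kernel N (y - snd p) = dirichlet_kernel N (snd p - y)"
      using dirichlet_kernel_minus[of N "snd p - y"] by simp
    finally show "(\<Sum>m = - int M..int M. \<Sum>n = - int N..int N. ?g m n p * ?c m n) = complex_of_real (4 * (f p * ?K p))"
      by (simp add: mult_ac)
  qed
  also have "set_lebesgue_integral lebesgue ?T (\<lambda>p. complex_of_real (4 * (f p * ?K p))) =
      of_real (4 * set_lebesgue_integral lebesgue ?T (\<lambda>p. f p * ?K p))"
    by (simp only: set_integral_complex_of_real set_integral_mult_right)
  finally show ?thesis by simp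
qed

lemma rect_partial_sum_eq_quadrants:
  fixes f :: "real \<times> real \<Rightarrow> real"
  assumes f [measurable]: "f \<in> borel_measurable lebesgue" and B: "\<And>p. \<bar>f p\<bar> \<le> B"
    and per1: "\<And>x y. f (x + 2 * pi, y) = f (x, y)"
    and per2: "\<And>x y. f (x, y + 2 * pi) = f (x, y)"
  shows "rect_partial_sum f M N (x, y) = of_real (1 / pi\<^sup>2 *
    (\<Sum>\<sigma>\<in>{1,-1}. \<Sum>\<tau>\<in>{1,-1}. quadrant_integral M N (\<lambda>p. f (reflect_shift \<sigma> \<tau> x y p))))"
proof -
  let ?H = "\<lambda>p. f p * (dirichlet_kernel M (fst p - x) * dirichlet_kernel N (snd p - y))"
  have H [measurable]: "?H \<in> borel_measurable lebesgue"
    by measurable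
  have B0: "0 \<le> B" using B[of undefined] by linarith
  have bound: "\<bar>?H p\<bar> \<le> B * ((real M + 1 / 2) * (real N + 1 / 2))" for p
    unfolding abs_mult[of "f p"]
    using B0 by (intro mult_mono B dirichlet_kernel_product_bound) auto
  have "set_lebesgue_integral lebesgue (torus \<times> torus) ?H =
      set_lebesgue_integral lebesgue ({x - pi..<x + pi} \<times> {y - pi..<y + pi}) ?H"
  proof (rule integral_torus_eq_shifted_box[OF H bound])
    show "?H (x' + 2 * pi * of_int k, y') = ?H (x', y')" for x' y' k
      using periodic_shift_int[of "\<lambda>x. f (x, y')", OF per1, of x' k] dirichlet_kernel_periodic[of M "x' - x" k]
      by (simp add: algebra_simps)
    show "?H (x', y' + 2 * pi * of_int k) = ?H (x', y')" for x' y' k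
      using periodic_shift_int[of "\<lambda>y. f (x', y)", OF per2, of y' k] dirichlet_kernel_periodic[of N "y' - y" k]
      by (simp add: algebra_simps)
  qed
  also have "\<dots> = (\<Sum>\<sigma>\<in>{1,-1}. \<Sum>\<tau>\<in>{1,-1}.
       set_lebesgue_integral lebesgue quadrant (\<lambda>p. ?H (reflect_shift \<sigma> \<tau> x y p)))"
    by (rule integral_box_eq_quadrants[OF H bound])
  \<comment> \<open>The kernels are even, so the signs disappear from them and only \<open>f\<close>
    is reflected.\<close>
  also have "\<dots> = (\<Sum>\<sigma>\<in>{1,-1}. \<Sum>\<tau>\<in>{1,-1}. quadrant_integral M N (\<lambda>p. f (reflect_shift \<sigma> \<tau> x y p)))"
    unfolding quadrant_integral_def
    by (intro sum.cong refl) (auto simp: reflect_shift_def)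
  finally show ?thesis
    by (simp only: rect_partial_sum_eq_integral[OF f B])
qed

text \<open>One predicate serves both claims: \<open>L\<close> holds the four quadrant limits for
  pointwise convergence and is constant for uniform convergence. The axes through
  \<open>(x, y)\<close> are excluded, in accordance with open quadrant limits.\<close>

definition quadrants_near ::
    "(real \<times> real \<Rightarrow> real) \<Rightarrow> real \<Rightarrow> real \<Rightarrow> (real \<Rightarrow> real \<Rightarrow> real) \<Rightarrow> real \<Rightarrow> real \<Rightarrow> bool" where
  "quadrants_near f x y L \<delta> \<eta> \<longleftrightarrow>
     (\<forall>\<sigma>\<in>{1,-1}. \<forall>\<tau>\<in>{1,-1}. \<forall>s t. 0 < s \<longrightarrow> s < \<delta> \<longrightarrow> 0 < t \<longrightarrow> t < \<delta> \<longrightarrow>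
        \<bar>f (x + \<sigma> * s, y + \<tau> * t) - L \<sigma> \<tau>\<bar> \<le> \<eta>)"

text \<open>In each quadrant the bound for small functions is applied to \<open>f\<close> minus
  \<open>L \<sigma> \<tau>\<close>, which has the same grid variation as \<open>f\<close>. The point
  and \<open>L\<close> are quantified innermost, so one \<open>n0\<close> serves all points that
  admit the same \<open>\<delta>\<close>.\<close>

lemma rect_partial_sum_close:
  fixes \<Lambda> :: "nat \<Rightarrow> real" and f :: "real \<times> real \<Rightarrow> real"
  assumes pos: "\<And>j. j \<ge> 1 \<Longrightarrow> \<Lambda> j > 0"
    and summ: "summable (\<lambda>j. \<Lambda> (Suc j) / real (Suc j) ^ 2)"
    and mono: "\<And>i j. 1 \<le> i \<Longrightarrow> i \<le> j \<Longrightarrow> \<Lambda> j / real j \<le> \<Lambda> i / real i"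
    and lim: "(\<lambda>j. \<Lambda> j / real j) \<longlonglongrightarrow> 0"
    and per1: "\<And>x y. f (x + 2 * pi, y) = f (x, y)"
    and per2: "\<And>x y. f (x, y + 2 * pi) = f (x, y)"
    and bv: "f \<in> PLambdaBV \<Lambda>"
    and int: "f absolutely_integrable_on torus \<times> torus"
    and e: "e > 0"
  shows "\<exists>\<eta>>0. \<forall>\<delta>>0. \<exists>n0. \<forall>M\<ge>n0. \<forall>N\<ge>n0. \<forall>x y L. quadrants_near f x y L \<delta> \<eta> \<longrightarrow>
       dist (rect_partial_sum f M N (x, y)) (of_real ((\<Sum>\<sigma>\<in>{1,-1}. \<Sum>\<tau>\<in>{1,-1}. L \<sigma> \<tau>) / 4)) \<le> e"
proof -
  obtain V where V0: "V \<ge> 0"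
    and V1: "\<And>\<sigma> x y. \<sigma> = 1 \<or> \<sigma> = -1 \<Longrightarrow> grid_variation_le \<Lambda> V (\<lambda>s. f (x + \<sigma> * s, y))"
    and V2: "\<And>\<tau> x y. \<tau> = 1 \<or> \<tau> = -1 \<Longrightarrow> grid_variation_le \<Lambda> V (\<lambda>t. f (x, y + \<tau> * t))"
    using PLambdaBV_grid_variation_le[OF pos bv per1 per2] by blast
  have meas: "f \<in> borel_measurable lebesgue"
    using int unfolding set_integrable_def
    by (intro periodic_borel_measurable_lebesgue[OF _ per1 per2])
      (auto simp: set_borel_measurable_def)
  define B where "B = \<bar>f (0, 0)\<bar> + 2 * V * \<Lambda> 1"
  have B: "\<bar>f p\<bar> \<le> B" for p
    unfolding B_def using pos V1[of 1 0] V2[of 1 _ 0]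
    by (intro periodic_grid_variation_bounded[OF _ per1 per2]) auto
  obtain \<eta> where \<eta>: "\<eta> > 0" and small: "\<And>\<delta>. \<delta> > 0 \<Longrightarrow> \<exists>n0. \<forall>M\<ge>n0. \<forall>N\<ge>n0. \<forall>\<phi> B. \<phi> \<in> borel_measurable lebesgue \<longrightarrow>
       (\<forall>p. \<bar>\<phi> p\<bar> \<le> B) \<longrightarrow>
       (\<forall>t. grid_variation_le \<Lambda> V (\<lambda>s. \<phi> (s, t))) \<longrightarrow> (\<forall>s. grid_variation_le \<Lambda> V (\<lambda>t. \<phi> (s, t))) \<longrightarrow>
       (\<forall>s t. 0 < s \<longrightarrow> s < \<delta> \<longrightarrow> 0 < t \<longrightarrow> t < \<delta> \<longrightarrow> \<bar>\<phi> (s, t)\<bar> \<le> \<eta>) \<longrightarrow>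
       \<bar>quadrant_integral M N \<phi>\<bar> \<le> e"
    using quadrant_integral_small[OF pos summ mono lim e V0] by blast
  show ?thesis
  proof (intro exI[of _ \<eta>] conjI \<eta> allI impI)
    fix \<delta> :: real assume \<delta>: "\<delta> > 0"
    obtain n0 where n0: "\<And>M N \<phi> B. M \<ge> n0 \<Longrightarrow> N \<ge> n0 \<Longrightarrow> \<phi> \<in> borel_measurable lebesgue \<Longrightarrow>
       (\<And>p. \<bar>\<phi> p\<bar> \<le> B) \<Longrightarrow>
       (\<And>t. grid_variation_le \<Lambda> V (\<lambda>s. \<phi> (s, t))) \<Longrightarrow> (\<And>s. grid_variation_le \<Lambda> V (\<lambda>t. \<phi> (s, t))) \<Longrightarrow>
       (\<And>s t. 0 < s \<Longrightarrow> s < \<delta> \<Longrightarrow> 0 < t \<Longrightarrow> t < \<delta> \<Longrightarrow> \<bar>\<phi> (s, t)\<bar> \<le> \<eta>) \<Longrightarrow>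
       \<bar>quadrant_integral M N \<phi>\<bar> \<le> e"
      using small[OF \<delta>] by blast
    have "dist (rect_partial_sum f M N (x, y)) (of_real ((\<Sum>\<sigma>\<in>{1,-1}. \<Sum>\<tau>\<in>{1,-1}. L \<sigma> \<tau>) / 4)) \<le> e"
      if MN: "M \<ge> n0" "N \<ge> n0"
        and L: "quadrants_near f x y L \<delta> \<eta>"
      for M N x y and L :: "real \<Rightarrow> real \<Rightarrow> real"
    proof -
      let ?f = "\<lambda>\<sigma> \<tau> p. f (reflect_shift \<sigma> \<tau> x y p)"
      let ?q = "\<lambda>\<sigma> \<tau>. quadrant_integral M N (?f \<sigma> \<tau>)"
      have f_meas: "?f \<sigma> \<tau> \<in> borel_measurable lebesgue" if "\<sigma> \<in> {1,-1}" "\<tau> \<in> {1,-1}" for \<sigma> \<tau>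
        using that by (intro measurable_compose[OF measurable_reflect_shift meas]) auto
      have q: "\<bar>?q \<sigma> \<tau> - L \<sigma> \<tau> * pi\<^sup>2 / 4\<bar> \<le> e" if \<sigma>\<tau>: "\<sigma> \<in> {1,-1}" "\<tau> \<in> {1,-1}" for \<sigma> \<tau>
      proof -
        have "?q \<sigma> \<tau> - L \<sigma> \<tau> * pi\<^sup>2 / 4 = ?q \<sigma> \<tau> - quadrant_integral M N (\<lambda>_. L \<sigma> \<tau>)"
          by (simp only: quadrant_integral_const)
        also have "\<dots> = quadrant_integral M N (\<lambda>p. ?f \<sigma> \<tau> p - L \<sigma> \<tau>)"
          unfolding quadrant_integral_def left_diff_distrib
          by (rule set_integral_diff(2)[symmetric])
            (rule quadrant_integrable[where B = B], use f_meas[OF \<sigma>\<tau>] B in auto,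
             rule quadrant_integrable[where B = "\<bar>L \<sigma> \<tau>\<bar>"], auto)
        also have "\<bar>\<dots>\<bar> \<le> e"
        proof (rule n0[OF MN, where B = "B + \<bar>L \<sigma> \<tau>\<bar>"])
          show "(\<lambda>p. ?f \<sigma> \<tau> p - L \<sigma> \<tau>) \<in> borel_measurable lebesgue"
            using f_meas[OF \<sigma>\<tau>] by measurable
          show "\<bar>?f \<sigma> \<tau> p - L \<sigma> \<tau>\<bar> \<le> B + \<bar>L \<sigma> \<tau>\<bar>" for p
            using B[of "reflect_shift \<sigma> \<tau> x y p"] by linarith
          show "grid_variation_le \<Lambda> V (\<lambda>s. ?f \<sigma> \<tau> (s, t) - L \<sigma> \<tau>)" for t
            using V1[of \<sigma> x "y + \<tau> * t"] \<sigma>\<tau> by (simp add: grid_variation_le_def reflect_shift_def)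
          show "grid_variation_le \<Lambda> V (\<lambda>t. ?f \<sigma> \<tau> (s, t) - L \<sigma> \<tau>)" for s
            using V2[of \<tau> "x + \<sigma> * s" y] \<sigma>\<tau> by (simp add: grid_variation_le_def reflect_shift_def)
          show "\<bar>?f \<sigma> \<tau> (s, t) - L \<sigma> \<tau>\<bar> \<le> \<eta>" if "0 < s" "s < \<delta>" "0 < t" "t < \<delta>" for s t
            using L \<sigma>\<tau> that by (simp only: reflect_shift_def fst_conv snd_conv quadrants_near_def)
        qed
        finally show ?thesis .
      qed
      have "dist (rect_partial_sum f M N (x, y)) (of_real ((\<Sum>\<sigma>\<in>{1,-1}. \<Sum>\<tau>\<in>{1,-1}. L \<sigma> \<tau>) / 4)) =
          \<bar>1 / pi\<^sup>2 * (\<Sum>\<sigma>\<in>{1,-1}. \<Sum>\<tau>\<in>{1,-1}. ?q \<sigma> \<tau>) - (\<Sum>\<sigma>\<in>{1,-1}. \<Sum>\<tau>\<in>{1,-1}. L \<sigma> \<tau>) / 4\<bar>"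
        unfolding rect_partial_sum_eq_quadrants[OF meas B per1 per2] dist_of_real by (simp only: dist_real_def)
      also have "\<dots> = \<bar>1 / pi\<^sup>2 * (\<Sum>\<sigma>\<in>{1,-1}. \<Sum>\<tau>\<in>{1,-1}. ?q \<sigma> \<tau> - L \<sigma> \<tau> * pi\<^sup>2 / 4)\<bar>"
        by (rule arg_cong[where f = abs]) (simp add: field_simps)
      also have "\<dots> = 1 / pi\<^sup>2 * \<bar>\<Sum>\<sigma>\<in>{1,-1}. \<Sum>\<tau>\<in>{1,-1}. ?q \<sigma> \<tau> - L \<sigma> \<tau> * pi\<^sup>2 / 4\<bar>"
        by (simp only: abs_mult) simp
      also have "\<dots> \<le> 1 / pi\<^sup>2 * (4 * e)"
      proof (rule mult_left_mono)
        have "\<bar>\<Sum>\<sigma>\<in>{1,-1}. \<Sum>\<tau>\<in>{1,-1}. ?q \<sigma> \<tau> - L \<sigma> \<tau> * pi\<^sup>2 / 4\<bar> \<le> (\<Sum>\<sigma>\<in>{1,-1::real}. \<Sum>\<tau>\<in>{1,-1::real}. e)"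
          by (intro order.trans[OF sum_abs] sum_mono q)
        then show "\<bar>\<Sum>\<sigma>\<in>{1,-1}. \<Sum>\<tau>\<in>{1,-1}. ?q \<sigma> \<tau> - L \<sigma> \<tau> * pi\<^sup>2 / 4\<bar> \<le> 4 * e"
          by simp
      qed simp
      \<comment> \<open>Four errors of size \<open>e\<close> are absorbed by the factor
        \<open>1 / pi\<^sup>2\<close>, because pi is at least 2.\<close>
      also have "\<dots> \<le> e"
      proof -
        have "4 \<le> pi\<^sup>2"
          using power_mono[OF pi_ge_two, of 2] by simp
        then show ?thesis using e by (simp add: divide_le_eq mult.commute)
      qed
      finally show ?thesis .
    qed
    then show "\<exists>n0. \<forall>M\<ge>n0. \<forall>N\<ge>n0. \<forall>x y L. quadrants_near f x y L \<delta> \<eta> \<longrightarrow>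
       dist (rect_partial_sum f M N (x, y)) (of_real ((\<Sum>\<sigma>\<in>{1,-1}. \<Sum>\<tau>\<in>{1,-1}. L \<sigma> \<tau>) / 4)) \<le> e"
      by blast
  qed
qed

section \<open>From quadrant limits and continuity to convergence\<close>

lemma dist_reflect_shift_less:
  fixes x y s t :: real
  assumes "\<bar>\<sigma>\<bar> = 1" "\<bar>\<tau>\<bar> = 1" "0 < s" "s < d / 2" "0 < t" "t < d / 2"
  shows "dist (x + \<sigma> * s, y + \<tau> * t) (x, y) < d"
proof -
  have "dist (x + \<sigma> * s, y + \<tau> * t) (x, y) \<le> \<bar>\<sigma> * s\<bar> + \<bar>\<tau> * t\<bar>"
    unfolding dist_Pair_Pair dist_real_def
    using sqrt_sum_squares_le_sum_abs[of "\<sigma> * s" "\<tau> * t"] by simp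
  also have "\<dots> < d"
    using assms by (simp add: abs_mult)
  finally show ?thesis .
qed

lemma quadrant_limit_bound:
  fixes f :: "real \<times> real \<Rightarrow> real"
  assumes lim: "(f \<longlongrightarrow> l) (at (x, y) within A)" and "\<eta> > 0"
    and A: "\<And>s t. 0 < s \<Longrightarrow> 0 < t \<Longrightarrow> (x + \<sigma> * s, y + \<tau> * t) \<in> A"
    and \<sigma>\<tau>: "\<bar>\<sigma>\<bar> = 1" "\<bar>\<tau>\<bar> = 1"
  shows "\<exists>d>0. \<forall>s t. 0 < s \<longrightarrow> s < d \<longrightarrow> 0 < t \<longrightarrow> t < d \<longrightarrow> \<bar>f (x + \<sigma> * s, y + \<tau> * t) - l\<bar> \<le> \<eta>"
proof -
  obtain d where d: "d > 0" "\<And>p. p \<in> A \<Longrightarrow> p \<noteq> (x, y) \<Longrightarrow> dist p (x, y) < d \<Longrightarrow> dist (f p) l < \<eta>"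
    using tendstoD[OF lim \<open>\<eta> > 0\<close>] unfolding eventually_at by blast
  have "\<bar>f (x + \<sigma> * s, y + \<tau> * t) - l\<bar> \<le> \<eta>" if "0 < s" "s < d / 2" "0 < t" "t < d / 2" for s t
  proof -
    have "(x + \<sigma> * s, y + \<tau> * t) \<noteq> (x, y)"
      using that \<sigma>\<tau> by auto
    then show ?thesis
      using d(2)[OF A[OF that(1,3)] _ dist_reflect_shift_less[OF \<sigma>\<tau> that]]
      by (simp add: dist_real_def less_imp_le)
  qed
  then show ?thesis
    using d(1) by (intro exI[of _ "d / 2"]) auto
qed

text \<open>Stronger than uniform continuity on \<open>K\<close>, since \<open>q\<close> may lie
  outside \<open>K\<close>, as points of the surrounding quadrants do. Open sets on which
  \<open>f\<close> oscillates by less than \<open>\<eta>\<close> cover \<open>K\<close>, and a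
  Lebesgue number of this cover is the radius.\<close>

lemma isCont_compact_uniform:
  fixes f :: "'a::metric_space \<Rightarrow> 'b::metric_space"
  assumes K: "compact K" and cont: "\<And>p. p \<in> K \<Longrightarrow> isCont f p" and "\<eta> > 0"
  obtains \<delta> where "\<delta> > 0" "\<And>p q. p \<in> K \<Longrightarrow> dist q p < \<delta> \<Longrightarrow> dist (f q) (f p) < \<eta>"
proof -
  define \<G> where "\<G> = {U. open U \<and> (\<forall>p\<in>U. \<forall>q\<in>U. dist (f q) (f p) < \<eta>)}"
  have "K \<subseteq> \<Union>\<G>"
  proof
    fix p assume "p \<in> K"
    then have "f \<midarrow>p\<rightarrow> f p"
      using cont by (simp add: isCont_def)
    then obtain d where d: "d > 0" "\<And>q. dist q p < d \<Longrightarrow> dist (f q) (f p) < \<eta> / 2"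
      using \<open>\<eta> > 0\<close> unfolding LIM_def by (metis dist_self half_gt_zero)
    have "dist (f r) (f q) < \<eta>" if "dist q p < d" "dist r p < d" for q r
      using dist_triangle_half_l[OF d(2)[OF that(2)] d(2)[OF that(1)]] .
    then have "ball p d \<in> \<G>"
      unfolding \<G>_def by (simp add: dist_commute)
    then show "p \<in> \<Union>\<G>"
      using d(1) by (intro UnionI[of "ball p d"]) auto
  qed
  then obtain \<delta> where \<delta>: "\<delta> > 0" "\<And>p. p \<in> K \<Longrightarrow> \<exists>U\<in>\<G>. ball p \<delta> \<subseteq> U"
    using Heine_Borel_lemma[OF K, of \<G>] unfolding \<G>_def by (metis (no_types, lifting) mem_Collect_eq)
  show ?thesis
  proof (rule that[OF \<delta>(1)])
    fix p q assume "p \<in> K" "dist q p < \<delta>"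
    then obtain U where U: "U \<in> \<G>" "ball p \<delta> \<subseteq> U"
      using \<delta>(2) by blast
    have "p \<in> U" "q \<in> U"
      using U(2) \<delta>(1) \<open>dist q p < \<delta>\<close> by (auto simp: dist_commute subset_iff)
    then show "dist (f q) (f p) < \<eta>"
      using U(1) unfolding \<G>_def by blast
  qed
qed

theorem theorem3:
  fixes \<Lambda> :: "nat \<Rightarrow> real" and f :: "real \<times> real \<Rightarrow> real"
  assumes "\<forall>j\<ge>1. \<Lambda> j > 0"
    and "summable (\<lambda>j. \<Lambda> (Suc j) / real (Suc j) ^ 2)"
    and "\<forall>i\<ge>1. \<forall>j\<ge>i. \<Lambda> j / real j \<le> \<Lambda> i / real i"
    and "(\<lambda>j. \<Lambda> j / real j) \<longlonglongrightarrow> 0"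
    and "\<forall>x y. f (x + 2 * pi, y) = f (x, y)"
    and "\<forall>x y. f (x, y + 2 * pi) = f (x, y)"
    and "f \<in> PLambdaBV \<Lambda>"
    and "f absolutely_integrable_on torus \<times> torus"
  shows "(\<forall>x y lpp lpm lmp lmm.
            (f \<longlongrightarrow> lpp) (at (x, y) within {x<..} \<times> {y<..}) \<longrightarrow>
            (f \<longlongrightarrow> lpm) (at (x, y) within {x<..} \<times> {..<y}) \<longrightarrow>
            (f \<longlongrightarrow> lmp) (at (x, y) within {..<x} \<times> {y<..}) \<longrightarrow>
            (f \<longlongrightarrow> lmm) (at (x, y) within {..<x} \<times> {..<y}) \<longrightarrow>
            ((\<lambda>(M, N). rect_partial_sum f M N (x, y)) \<longlongrightarrow>
               complex_of_real ((lpp + lpm + lmp + lmm) / 4)) pringsheim) \<and>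
         (\<forall>K. compact K \<longrightarrow> (\<forall>p\<in>K. isCont f p) \<longrightarrow>
            uniform_limit K (\<lambda>(M, N). rect_partial_sum f M N)
              (\<lambda>p. complex_of_real (f p)) pringsheim)"
proof (rule conjI; intro allI impI)
  have pos: "0 < \<Lambda> j" if "1 \<le> j" for j
    using assms(1) that by blast
  have mono: "\<Lambda> j / real j \<le> \<Lambda> i / real i" if "1 \<le> i" "i \<le> j" for i j
    using assms(3) that by blast
  have per1: "f (x + 2 * pi, y) = f (x, y)" and per2: "f (x, y + 2 * pi) = f (x, y)" for x y
    using assms(5,6) by blast+
  have close: "\<exists>\<eta>>0. \<forall>\<delta>>0. \<exists>n0. \<forall>M\<ge>n0. \<forall>N\<ge>n0. \<forall>x y L. quadrants_near f x y L \<delta> \<eta> \<longrightarrow>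
       dist (rect_partial_sum f M N (x, y)) (of_real ((\<Sum>\<sigma>\<in>{1,-1}. \<Sum>\<tau>\<in>{1,-1}. L \<sigma> \<tau>) / 4)) \<le> e"
    if "e > 0" for e
    by (rule rect_partial_sum_close[OF pos assms(2) mono assms(4) per1 per2 assms(7,8) that])
  {
    fix x y lpp lpm lmp lmm
    assume pp: "(f \<longlongrightarrow> lpp) (at (x, y) within {x<..} \<times> {y<..})"
      and pm: "(f \<longlongrightarrow> lpm) (at (x, y) within {x<..} \<times> {..<y})"
      and mp: "(f \<longlongrightarrow> lmp) (at (x, y) within {..<x} \<times> {y<..})"
      and mm: "(f \<longlongrightarrow> lmm) (at (x, y) within {..<x} \<times> {..<y})"
    define L :: "real \<Rightarrow> real \<Rightarrow> real"
      where "L \<sigma> \<tau> = (if \<sigma> = 1 then if \<tau> = 1 then lpp else lpm else if \<tau> = 1 then lmp else lmm)" for \<sigma> \<tau>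
    have L_sum: "(\<Sum>\<sigma>\<in>{1,-1}. \<Sum>\<tau>\<in>{1,-1}. L \<sigma> \<tau>) = lpp + lpm + lmp + lmm"
      by (simp add: L_def)
    show "((\<lambda>(M, N). rect_partial_sum f M N (x, y)) \<longlongrightarrow>
               complex_of_real ((lpp + lpm + lmp + lmm) / 4)) pringsheim"
    proof (rule tendstoI)
      fix e :: real assume "e > 0"
      \<comment> \<open>Halving \<open>e\<close> turns the non-strict bound into the strict one in
        the definition of a limit.\<close>
      from close[OF half_gt_zero[OF this]] obtain \<eta> where \<eta>: "\<eta> > 0" and close\<eta>: "\<forall>\<delta>>0. \<exists>n0. \<forall>M\<ge>n0. \<forall>N\<ge>n0. \<forall>x y L. quadrants_near f x y L \<delta> \<eta> \<longrightarrow>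
       dist (rect_partial_sum f M N (x, y)) (of_real ((\<Sum>\<sigma>\<in>{1,-1}. \<Sum>\<tau>\<in>{1,-1}. L \<sigma> \<tau>) / 4)) \<le> e / 2"
        by (elim exE conjE) (rule that)
      have "\<exists>d>0. \<forall>s t. 0 < s \<longrightarrow> s < d \<longrightarrow> 0 < t \<longrightarrow> t < d \<longrightarrow> \<bar>f (x + \<sigma> * s, y + \<tau> * t) - L \<sigma> \<tau>\<bar> \<le> \<eta>"
        if "\<sigma> \<in> {1,-1}" "\<tau> \<in> {1,-1}" for \<sigma> \<tau>
        using that quadrant_limit_bound[OF pp \<eta>, of 1 1] quadrant_limit_bound[OF pm \<eta>, of 1 "-1"]
          quadrant_limit_bound[OF mp \<eta>, of "-1" 1] quadrant_limit_bound[OF mm \<eta>, of "-1" "-1"]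
        by (auto simp: L_def)
      then obtain d where d: "\<And>\<sigma> \<tau>. \<sigma> \<in> {1,-1} \<Longrightarrow> \<tau> \<in> {1,-1} \<Longrightarrow> d \<sigma> \<tau> > 0 \<and>
          (\<forall>s t. 0 < s \<longrightarrow> s < d \<sigma> \<tau> \<longrightarrow> 0 < t \<longrightarrow> t < d \<sigma> \<tau> \<longrightarrow> \<bar>f (x + \<sigma> * s, y + \<tau> * t) - L \<sigma> \<tau>\<bar> \<le> \<eta>)"
        by metis
      \<comment> \<open>The four limits come with separate radii; the smallest works in every
        quadrant.\<close>
      define \<delta> where "\<delta> = Min ((\<lambda>(\<sigma>, \<tau>). d \<sigma> \<tau>) ` ({1,-1} \<times> {1,-1}))"
      have "\<delta> > 0"
        unfolding \<delta>_def by (subst Min_gr_iff) (use d in auto)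
      then obtain n0 where n0: "\<And>M N x y L. M \<ge> n0 \<Longrightarrow> N \<ge> n0 \<Longrightarrow> quadrants_near f x y L \<delta> \<eta> \<Longrightarrow>
         dist (rect_partial_sum f M N (x, y)) (of_real ((\<Sum>\<sigma>\<in>{1,-1}. \<Sum>\<tau>\<in>{1,-1}. L \<sigma> \<tau>) / 4)) \<le> e / 2"
        using close\<eta> by blast
      moreover have "quadrants_near f x y L \<delta> \<eta>"
        unfolding quadrants_near_def
      proof (intro ballI allI impI)
        fix \<sigma> \<tau> s t :: real
        assume \<sigma>\<tau>: "\<sigma> \<in> {1,-1}" "\<tau> \<in> {1,-1}" and st: "0 < s" "s < \<delta>" "0 < t" "t < \<delta>"
        have "\<delta> \<le> d \<sigma> \<tau>"
          unfolding \<delta>_def using \<sigma>\<tau> by (intro Min_le) auto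
        then show "\<bar>f (x + \<sigma> * s, y + \<tau> * t) - L \<sigma> \<tau>\<bar> \<le> \<eta>"
          using d[OF \<sigma>\<tau>] st by auto
      qed
      ultimately have "dist (rect_partial_sum f M N (x, y)) (of_real ((\<Sum>\<sigma>\<in>{1,-1}. \<Sum>\<tau>\<in>{1,-1}. L \<sigma> \<tau>) / 4)) \<le> e / 2"
        if "M \<ge> n0" "N \<ge> n0" for M N
        using that by blast
      then show "\<forall>\<^sub>F MN in pringsheim. dist (case MN of (M, N) \<Rightarrow> rect_partial_sum f M N (x, y))
          (complex_of_real ((lpp + lpm + lmp + lmm) / 4)) < e"
        unfolding eventually_prod_sequentially L_sum using \<open>e > 0\<close> by (intro exI[of _ n0]) force
    qed
  next
    fix K assume K: "compact K" "\<forall>p\<in>K. isCont f p"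
    show "uniform_limit K (\<lambda>(M, N). rect_partial_sum f M N) (\<lambda>p. complex_of_real (f p)) pringsheim"
    proof (rule uniform_limitI)
      fix e :: real assume "e > 0"
      from close[OF half_gt_zero[OF this]] obtain \<eta> where \<eta>: "\<eta> > 0" and close\<eta>: "\<forall>\<delta>>0. \<exists>n0. \<forall>M\<ge>n0. \<forall>N\<ge>n0. \<forall>x y L. quadrants_near f x y L \<delta> \<eta> \<longrightarrow>
       dist (rect_partial_sum f M N (x, y)) (of_real ((\<Sum>\<sigma>\<in>{1,-1}. \<Sum>\<tau>\<in>{1,-1}. L \<sigma> \<tau>) / 4)) \<le> e / 2"
        by (elim exE conjE) (rule that)
      obtain d where d: "d > 0" "\<And>p q. p \<in> K \<Longrightarrow> dist q p < d \<Longrightarrow> dist (f q) (f p) < \<eta>"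
        using isCont_compact_uniform[OF K(1) _ \<eta>] K(2) by blast
      obtain n0 where n0: "\<And>M N x y L. M \<ge> n0 \<Longrightarrow> N \<ge> n0 \<Longrightarrow> quadrants_near f x y L (d / 2) \<eta> \<Longrightarrow>
         dist (rect_partial_sum f M N (x, y)) (of_real ((\<Sum>\<sigma>\<in>{1,-1}. \<Sum>\<tau>\<in>{1,-1}. L \<sigma> \<tau>) / 4)) \<le> e / 2"
        using close\<eta> half_gt_zero[OF d(1)] by blast
      have "dist (rect_partial_sum f M N p) (complex_of_real (f p)) < e"
        if MN: "M \<ge> n0" "N \<ge> n0" and p: "p \<in> K" for M N p
      proof -
        obtain x y where xy: "p = (x, y)" by (cases p)
        \<comment> \<open>At a point of continuity the four quadrant values are all
          \<open>f p\<close>, and so is their mean. The radius is the same for all of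
          \<open>K\<close>, hence so is \<open>n0\<close>.\<close>
        have "quadrants_near f x y (\<lambda>_ _. f p) (d / 2) \<eta>"
          unfolding quadrants_near_def
        proof (intro ballI allI impI)
          fix \<sigma> \<tau> s t :: real
          assume "\<sigma> \<in> {1,-1}" "\<tau> \<in> {1,-1}" "0 < s" "s < d / 2" "0 < t" "t < d / 2"
          then have "dist (x + \<sigma> * s, y + \<tau> * t) p < d"
            unfolding xy by (intro dist_reflect_shift_less) auto
          then show "\<bar>f (x + \<sigma> * s, y + \<tau> * t) - f p\<bar> \<le> \<eta>"
            using d(2)[OF p] by (simp add: dist_real_def less_imp_le)
        qed
        then have "dist (rect_partial_sum f M N (x, y))
            (of_real ((\<Sum>\<sigma>\<in>{1,-1::real}. \<Sum>\<tau>\<in>{1,-1::real}. f p) / 4)) \<le> e / 2"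
          by (rule n0[OF MN])
        then show ?thesis using \<open>e > 0\<close> by (simp add: xy)
      qed
      then show "\<forall>\<^sub>F MN in pringsheim. \<forall>p\<in>K. dist ((case MN of (M, N) \<Rightarrow> rect_partial_sum f M N) p) (complex_of_real (f p)) < e"
        unfolding eventually_prod_sequentially by (intro exI[of _ n0]) auto
    qed
  }
qed

end
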